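(* Let $G$ be a permutation group of odd order on a finite set $\Omega$. Then the generalized base number of the coherent configuration $\mathrm{Inv}(G)$ is at most $1$, i.e. $gb(\mathrm{Inv}(G))\le 1$.
   Context: A coherent configuration on a finite set $\Omega$ is a pair $\mathcal X=(\Omega,S)$ where $S$ is a partition of $\Omega\times\Omega$ such that the diagonal $1_\Omega$ is a union of elements of $S$, $s^*=\{(\beta,\alpha):(\alpha,\beta)\in s\}\in S$ for every $s\in S$, and for all $r,s,t\in S$ the number $c_{rs}^t=|\{\gamma:(\alpha,\gamma)\in r,(\gamma,\beta)\in s\}|$ does not depend on $(\alpha,\beta)\in t$. Elements of $S$ are basic relations, their unions are relations. A fiber is a set $\Gamma\subseteq\Omega$ with $1_\Gamma=\{(\gamma,\gamma):\gamma\in\Gamma\}\in S$. $\mathcal X\le \mathcal X'$ (fission) means every relation of $\mathcal X$ is a relation of $\mathcal X'$. $\mathcal X$ is complete if every basic relation is a singleton. For $\Pi\subseteq 2^\Omega$, the $\Pi$-fission of $\mathcal X$ is the smallest fission of $\mathcal X$ in which every element of $\Pi$ is a union of fibers; $\Pi$ is a generalized base of $\mathcal X$ if the $\Pi$-fission is complete, and $gb(\mathcal X)$ is the minimum size of a generalized base. For $G\le \mathrm{Sym}(\Omega)$, $\mathrm{Inv}(G)=(\Omega,S)$ with $S$ the set of orbits of $G$ acting componentwise on $\Omega\times\Omega$. *)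

theory Defs
  imports "HOL-Algebra.Bij"
begin

text \<open>A coherent configuration on a finite set Omega, given by its set S of basic relations.\<close>
definition coherent_config :: "'a set \<Rightarrow> ('a \<times> 'a) set set \<Rightarrow> bool" where
  "coherent_config \<Omega> S \<longleftrightarrow>
     finite \<Omega> \<and>
     (\<forall>s\<in>S. s \<noteq> {}) \<and> \<Union>S = \<Omega> \<times> \<Omega> \<and>
     (\<forall>s\<in>S. \<forall>s'\<in>S. s \<noteq> s' \<longrightarrow> s \<inter> s' = {}) \<and>
     (\<exists>T\<subseteq>S. \<Union>T = Id_on \<Omega>) \<and>
     (\<forall>s\<in>S. converse s \<in> S) \<and>
     (\<forall>r\<in>S. \<forall>s\<in>S. \<forall>t\<in>S. \<exists>c::nat. \<forall>(a,b)\<in>t.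
        card {g. (a,g) \<in> r \<and> (g,b) \<in> s} = c)"

definition relations :: "('a \<times> 'a) set set \<Rightarrow> ('a \<times> 'a) set set" where
  "relations S = {\<Union>T | T. T \<subseteq> S}"

definition fission_le :: "('a \<times> 'a) set set \<Rightarrow> ('a \<times> 'a) set set \<Rightarrow> bool" where
  "fission_le S S' \<longleftrightarrow> relations S \<subseteq> relations S'"

definition fibers :: "'a set \<Rightarrow> ('a \<times> 'a) set set \<Rightarrow> 'a set set" where
  "fibers \<Omega> S = {\<Gamma>. \<Gamma> \<subseteq> \<Omega> \<and> Id_on \<Gamma> \<in> S}"

definition complete_cc :: "('a \<times> 'a) set set \<Rightarrow> bool" where
  "complete_cc S \<longleftrightarrow> (\<forall>s\<in>S. \<exists>p. s = {p})"

definition Pi_admissible :: "'a set \<Rightarrow> ('a \<times> 'a) set set \<Rightarrow> 'a set set \<Rightarrow> ('a \<times> 'a) set set \<Rightarrow> bool" where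
  "Pi_admissible \<Omega> S PP S' \<longleftrightarrow>
     coherent_config \<Omega> S' \<and> fission_le S S' \<and>
     (\<forall>P\<in>PP. \<exists>F\<subseteq>fibers \<Omega> S'. \<Union>F = P)"

definition is_Pi_fission :: "'a set \<Rightarrow> ('a \<times> 'a) set set \<Rightarrow> 'a set set \<Rightarrow> ('a \<times> 'a) set set \<Rightarrow> bool" where
  "is_Pi_fission \<Omega> S PP S' \<longleftrightarrow>
     Pi_admissible \<Omega> S PP S' \<and> (\<forall>S''. Pi_admissible \<Omega> S PP S'' \<longrightarrow> fission_le S' S'')"

definition generalized_base :: "'a set \<Rightarrow> ('a \<times> 'a) set set \<Rightarrow> 'a set set \<Rightarrow> bool" where
  "generalized_base \<Omega> S PP \<longleftrightarrow> PP \<subseteq> Pow \<Omega> \<and>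
     (\<exists>S'. is_Pi_fission \<Omega> S PP S' \<and> complete_cc S')"

definition gb :: "'a set \<Rightarrow> ('a \<times> 'a) set set \<Rightarrow> nat" where
  "gb \<Omega> S = (LEAST n. \<exists>PP. generalized_base \<Omega> S PP \<and> card PP = n)"

definition Inv :: "'a set \<Rightarrow> ('a \<Rightarrow> 'a) set \<Rightarrow> ('a \<times> 'a) set set" where
  "Inv \<Omega> G = {{(g a, g b) | g. g \<in> G} | a b. a \<in> \<Omega> \<and> b \<in> \<Omega>}"

end

theory Submission
  imports Defs "HOL-Algebra.Multiplicative_Group"
begin

text \<open>
  Since \<open>|G|\<close> is odd, no element of \<open>G\<close> swaps two points, so \<open>Inv(G)\<close> is antisymmetric: no basic
  relation off the diagonal is its own converse. This is all that is used; by induction on the number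
  of points, every antisymmetric configuration has a set \<open>D\<close> (called good) whose being a union of
  fibers forces completeness.

  The key gadget is that homogeneous antisymmetric configurations have an odd number of points and
  that complements of good sets are good, so a good set may be chosen to contain more than half, or
  less than half, of the points; the size of \<open>D\<close> on a fiber or block thus carries one bit. If there are
  several fibers, take the union of good sets of the fibers. If there is a proper system of blocks, take
  a good set in each block, whose majority bit encodes a good set of the quotient.

  In the primitive case fix a point \<open>x\<close>, which splits the rest into pieces \<open>{u. c x u = s}\<close>, and a half
  system \<open>P\<close>, containing exactly one of each pair of converse colours. Let \<open>D\<close> contain \<open>x\<close>, a majority
  set of the pieces with \<open>s \<in> P\<close> and a minority set of the others. If another point \<open>f\<close> were in the
  fiber of \<open>x\<close>, then for \<open>s, t \<in> P\<close> the paths from \<open>x\<close> to \<open>f\<close> with colours \<open>s, t\<close> and the paths of the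
  same kind into \<open>x\<close> would have their midpoints in \<open>D\<close> equally often, although the former lie in a majority
  piece and the latter in a minority piece. So \<open>x\<close> is fixed and the pieces can be resolved one by one.
  To make sense of the majorities, the piece has to be split into fibers of a fission in which \<open>f\<close> is
  fixed; hence the colours are ordered by levels, every colour of positive level being, up to
  converse, contained in a product of half-system colours of smaller level. That all colours get a
  level follows from the fact that in a strongly connected quasi-transitive digraph the non-adjacency
  graph is disconnected. The piece of a colour \<open>r\<close> of minimal degree has level zero and needs no set at
  all: any two of its points are separated by a point outside it.
\<close>

section \<open>Coherent colourings\<close>

text \<open>A configuration is encoded by a map \<open>c\<close> constant on exactly the basic relations, and
  \<open>refines V c P\<close> for a predicate \<open>P\<close> says that \<open>P\<close> is a relation of the configuration.\<close>
definition coherent :: "'a set \<Rightarrow> ('a \<Rightarrow> 'a \<Rightarrow> 'c) \<Rightarrow> bool" where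
  "coherent V c \<longleftrightarrow> finite V \<and>
     (\<forall>x\<in>V. \<forall>y\<in>V. \<forall>z\<in>V. c x x = c y z \<longrightarrow> y = z) \<and>
     (\<forall>x\<in>V. \<forall>y\<in>V. \<forall>u\<in>V. \<forall>v\<in>V. c x y = c u v \<longrightarrow> c y x = c v u \<and>
        (\<forall>i j. card {z\<in>V. c x z = i \<and> c z y = j} = card {z\<in>V. c u z = i \<and> c z v = j}))"

definition refines :: "'a set \<Rightarrow> ('a \<Rightarrow> 'a \<Rightarrow> 'c) \<Rightarrow> ('a \<Rightarrow> 'a \<Rightarrow> 'd) \<Rightarrow> bool" where
  "refines V d c \<longleftrightarrow> (\<forall>x\<in>V. \<forall>y\<in>V. \<forall>u\<in>V. \<forall>v\<in>V. d x y = d u v \<longrightarrow> c x y = c u v)"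

definition antisymmetric :: "'a set \<Rightarrow> ('a \<Rightarrow> 'a \<Rightarrow> 'c) \<Rightarrow> bool" where
  "antisymmetric V c \<longleftrightarrow> (\<forall>x\<in>V. \<forall>y\<in>V. c x y = c y x \<longrightarrow> x = y)"

definition fibre_union :: "'a set \<Rightarrow> ('a \<Rightarrow> 'a \<Rightarrow> 'c) \<Rightarrow> 'a set \<Rightarrow> bool" where
  "fibre_union V d D \<longleftrightarrow> (\<forall>x\<in>V. \<forall>y\<in>V. d x x = d y y \<longrightarrow> (x \<in> D \<longleftrightarrow> y \<in> D))"

text \<open>It is enough to quantify over colours of one type, as every configuration can be coloured by
  its basic relations themselves.\<close>
definition good :: "'a set \<Rightarrow> ('a \<Rightarrow> 'a \<Rightarrow> 'c) \<Rightarrow> 'a set \<Rightarrow> bool" where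
  "good V c D \<longleftrightarrow> D \<subseteq> V \<and>
     (\<forall>d :: 'a \<Rightarrow> 'a \<Rightarrow> ('a \<times> 'a) set. coherent V d \<longrightarrow> refines V d c \<longrightarrow> fibre_union V d D
        \<longrightarrow> inj_on (\<lambda>x. d x x) V)"

lemma refinesD: "refines V d c \<Longrightarrow> d x y = d u v \<Longrightarrow> x \<in> V \<Longrightarrow> y \<in> V \<Longrightarrow> u \<in> V \<Longrightarrow> v \<in> V \<Longrightarrow> c x y = c u v"
  unfolding refines_def by blast

lemma refines_refl: "refines V c c"
  by (simp add: refines_def)

lemma refines_trans: "refines V d c \<Longrightarrow> refines V c b \<Longrightarrow> refines V d b"
  unfolding refines_def by blast

lemma refines_subset: "refines V d c \<Longrightarrow> W \<subseteq> V \<Longrightarrow> refines W d c"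
  unfolding refines_def by blast

lemma antisymmetric_subset: "antisymmetric V c \<Longrightarrow> W \<subseteq> V \<Longrightarrow> antisymmetric W c"
  unfolding antisymmetric_def by blast

lemma antisymmetric_refines: "antisymmetric V c \<Longrightarrow> refines V d c \<Longrightarrow> antisymmetric V d"
  unfolding antisymmetric_def refines_def by metis

lemma coherent_finite: "coherent V c \<Longrightarrow> finite V"
  by (simp add: coherent_def)

lemma coherent_diag: "coherent V c \<Longrightarrow> c x x = c y z \<Longrightarrow> x \<in> V \<Longrightarrow> y \<in> V \<Longrightarrow> z \<in> V \<Longrightarrow> y = z"
  unfolding coherent_def by blast

lemma coherent_converse:
  "coherent V c \<Longrightarrow> c x y = c u v \<Longrightarrow> x \<in> V \<Longrightarrow> y \<in> V \<Longrightarrow> u \<in> V \<Longrightarrow> v \<in> V \<Longrightarrow> c y x = c v u"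
  unfolding coherent_def by blast

lemma refines_converse: "coherent V c \<Longrightarrow> refines V c (\<lambda>x y. c y x)"
  unfolding refines_def by (blast dest: coherent_converse)

lemma refines_comp: "refines V c f \<Longrightarrow> refines V c (\<lambda>x y. h (f x y))"
  unfolding refines_def by metis

lemma refines_comp2: "refines V c f \<Longrightarrow> refines V c g \<Longrightarrow> refines V c (\<lambda>x y. h (f x y) (g x y))"
  unfolding refines_def by metis

lemma coherent_card:
  assumes c: "coherent V c" and P: "refines V c P" and Q: "refines V c Q"
  shows "refines V c (\<lambda>x y. card {z\<in>V. P x z \<and> Q z y})"
  unfolding refines_def
proof (intro ballI impI)
  fix x y u v assume V: "x \<in> V" "y \<in> V" "u \<in> V" "v \<in> V" and eq: "c x y = c u v"
  have fin: "finite V" using c by (rule coherent_finite)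
  \<comment> \<open>The midpoints are sorted by the colours of their two arcs, so that the count
    becomes a sum of intersection numbers. \<open>T\<close> lists the pairs of colours of which the
    first satisfies \<open>P\<close> and the second satisfies \<open>Q\<close>; it is finite because
    \<open>V\<close> is.\<close>
  define T where "T = (\<lambda>(a, b). c a b) ` {(a, b) \<in> V \<times> V. P a b} \<times> (\<lambda>(a, b). c a b) ` {(a, b) \<in> V \<times> V. Q a b}"
  have finT: "finite T"
    unfolding T_def by (intro finite_cartesian_product finite_imageI)
      (auto intro: finite_subset[OF _ finite_cartesian_product[OF fin fin]])
  have *: "card {z\<in>V. P a z \<and> Q z b} = (\<Sum>t\<in>T. card {z\<in>V. c a z = fst t \<and> c z b = snd t})"
    if ab: "a \<in> V" "b \<in> V" for a b
  proof -
    have "{z\<in>V. P a z \<and> Q z b} = (\<Union>t\<in>T. {z\<in>V. c a z = fst t \<and> c z b = snd t})"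
    proof (intro subset_antisym subsetI)
      fix z assume "z \<in> {z\<in>V. P a z \<and> Q z b}"
      then have "(c a z, c z b) \<in> T" and "z \<in> V"
        using ab unfolding T_def by (auto simp: image_iff)
      then show "z \<in> (\<Union>t\<in>T. {z\<in>V. c a z = fst t \<and> c z b = snd t})" by force
    next
      fix z assume "z \<in> (\<Union>t\<in>T. {z\<in>V. c a z = fst t \<and> c z b = snd t})"
      then obtain p q r s where z: "z \<in> V" "p \<in> V" "q \<in> V" "r \<in> V" "s \<in> V"
        "P p q" "Q r s" "c a z = c p q" "c z b = c r s"
        unfolding T_def by auto
      then show "z \<in> {z\<in>V. P a z \<and> Q z b}"
        using refinesD[OF P, of a z p q] refinesD[OF Q, of z b r s] ab by auto
    qed
    also have "card \<dots> = (\<Sum>t\<in>T. card {z\<in>V. c a z = fst t \<and> c z b = snd t})"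
      by (rule card_UN_disjoint) (use finT fin in \<open>auto simp: prod_eq_iff\<close>)
    finally show ?thesis .
  qed
  have "card {z\<in>V. c x z = i \<and> c z y = j} = card {z\<in>V. c u z = i \<and> c z v = j}" for i j
    using c V eq unfolding coherent_def by blast
  then show "card {z\<in>V. P x z \<and> Q z y} = card {z\<in>V. P u z \<and> Q z v}"
    using * V by simp
qed

lemma coherent_path:
  assumes c: "coherent V c" and P: "refines V c P" and Q: "refines V c Q"
    and eq: "c x y = c u v" and V: "x \<in> V" "y \<in> V" "u \<in> V" "v \<in> V"
    and z: "z \<in> V" "P x z" "Q z y"
  shows "\<exists>w\<in>V. P u w \<and> Q w v"
proof -
  have "card {z\<in>V. P x z \<and> Q z y} > 0"
    using z coherent_finite[OF c] by (auto simp: card_gt_0_iff)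
  then have "card {z\<in>V. P u z \<and> Q z v} > 0"
    using refinesD[OF coherent_card[OF c P Q] eq V] by simp
  then show ?thesis by (auto simp: card_gt_0_iff)
qed

lemma coherent_relcomp:
  assumes "coherent V c" "refines V c P" "refines V c Q"
  shows "refines V c (\<lambda>x y. \<exists>z\<in>V. P x z \<and> Q z y)"
  unfolding refines_def
proof (intro ballI impI)
  fix x y u v assume V: "x \<in> V" "y \<in> V" "u \<in> V" "v \<in> V" and eq: "c x y = c u v"
  show "(\<exists>z\<in>V. P x z \<and> Q z y) = (\<exists>z\<in>V. P u z \<and> Q z v)"
    using coherent_path[OF assms eq V] coherent_path[OF assms eq[symmetric] V(3,4,1,2)] by blast
qed

text \<open>The degenerate path from \<open>x\<close> through \<open>x\<close> to \<open>y\<close>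
  has a copy with the same colours from \<open>u\<close> to \<open>v\<close>. The first arc of the
  copy has a diagonal colour, so it is a loop at \<open>u\<close>.\<close>

lemma coherent_fst:
  assumes c: "coherent V c" and eq: "c x y = c u v" and V: "x \<in> V" "y \<in> V" "u \<in> V" "v \<in> V"
  shows "c x x = c u u"
proof -
  have "\<exists>w\<in>V. c u w = c x x \<and> c w v = c x y"
    by (rule coherent_path[OF c refines_comp[OF refines_refl, of _ _ "\<lambda>t. t = c x x"]
          refines_comp[OF refines_refl, of _ _ "\<lambda>t. t = c x y"] eq V V(1)]) auto
  then show ?thesis using coherent_diag[OF c] V by metis
qed

lemma coherent_snd:
  assumes c: "coherent V c" and eq: "c x y = c u v" and V: "x \<in> V" "y \<in> V" "u \<in> V" "v \<in> V"
  shows "c y y = c v v"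
  using coherent_fst[OF c coherent_converse[OF c eq V]] V by blast

lemma coherent_degree:
  assumes c: "coherent V c" and P: "refines V c P" and eq: "c x x = c u u" and V: "x \<in> V" "u \<in> V"
  shows "card {z\<in>V. P x z} = card {z\<in>V. P u z}"
  using refinesD[OF coherent_card[OF c P, of "\<lambda>_ _. True"] eq V(1,1,2,2)]
  by (simp add: refines_def)

lemma refines_fibre_union_snd:
  assumes c: "coherent V c" and D: "fibre_union V c D"
  shows "refines V c (\<lambda>x y. y \<in> D)"
  unfolding refines_def
proof (intro ballI impI)
  fix x y u v assume V: "x \<in> V" "y \<in> V" "u \<in> V" "v \<in> V" and eq: "c x y = c u v"
  then show "(y \<in> D) = (v \<in> D)"
    using D coherent_snd[OF c eq V] unfolding fibre_union_def by blast
qed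

text \<open>Membership in \<open>W\<close> need only be visible from points of \<open>W\<close>:
  adding the condition \<open>P\<close> to the first arc of a path keeps the counted midpoints
  inside \<open>W\<close>. This covers unions of fibers and also the blocks of an equivalence
  relation of the configuration, which need not be unions of fibers.\<close>

lemma coherent_restrict_rel:
  assumes c: "coherent V c" and P: "refines V c P" and W: "W \<subseteq> V"
    and WP: "\<And>x y. x \<in> W \<Longrightarrow> y \<in> V \<Longrightarrow> P x y \<longleftrightarrow> y \<in> W"
  shows "coherent W c"
  unfolding coherent_def
proof (intro conjI ballI impI allI)
  show "finite W" using c W coherent_finite finite_subset by blast
next
  fix x y z assume "x \<in> W" "y \<in> W" "z \<in> W" "c x x = c y z"
  then show "y = z" using coherent_diag[OF c] W by blast
next
  fix x y u v assume "x \<in> W" "y \<in> W" "u \<in> W" "v \<in> W" "c x y = c u v"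
  then show "c y x = c v u" using coherent_converse[OF c] W by blast
next
  fix x y u v i j assume V: "x \<in> W" "y \<in> W" "u \<in> W" "v \<in> W" and eq: "c x y = c u v"
  have "card {z\<in>V. (c x z = i \<and> P x z) \<and> c z y = j} = card {z\<in>V. (c u z = i \<and> P u z) \<and> c z v = j}"
    using refinesD[OF coherent_card[OF c, of "\<lambda>x z. c x z = i \<and> P x z" "\<lambda>z y. c z y = j"] eq]
      refines_comp2[OF refines_refl P, of "\<lambda>a b. a = i \<and> b"]
      refines_comp[OF refines_refl, of V c "\<lambda>a. a = j"] V W by blast
  moreover have "{z\<in>V. (c a z = i \<and> P a z) \<and> c z b = j} = {z\<in>W. c a z = i \<and> c z b = j}"
    if "a \<in> W" for a b using WP[OF that] W by blast
  ultimately show "card {z\<in>W. c x z = i \<and> c z y = j} = card {z\<in>W. c u z = i \<and> c z v = j}"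
    using V by simp
qed

lemma coherent_restrict_fibres:
  assumes c: "coherent V c" and W: "W \<subseteq> V" and r: "fibre_union V c W"
  shows "coherent W c"
  by (rule coherent_restrict_rel[OF c refines_fibre_union_snd[OF c r] W]) simp

section \<open>Quasi-transitive digraphs\<close>

lemma rtrancl_crossing:
  assumes "(x, y) \<in> r\<^sup>*" "x \<notin> S" "y \<in> S"
  shows "\<exists>p q. (p, q) \<in> r \<and> p \<notin> S \<and> q \<in> S"
proof -
  have "y \<in> S \<longrightarrow> (\<exists>p q. (p, q) \<in> r \<and> p \<notin> S \<and> q \<in> S)"
    using assms(1) by induction (use assms(2) in auto)
  then show ?thesis using assms(3) by blast
qed

definition connected_on :: "('a \<times> 'a) set \<Rightarrow> 'a set \<Rightarrow> bool" where
  "connected_on r W \<longleftrightarrow> (\<forall>x\<in>W. \<forall>y\<in>W. (x, y) \<in> (r \<inter> W \<times> W)\<^sup>*)"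

text \<open>A vertex at distance \<open>j \<ge> 2\<close> from \<open>z\<close> has an arc back to a
  vertex at distance \<open>j - 2\<close>, so that by parity it has an arc to \<open>z\<close> or to \<open>r\<close>.\<close>
lemma quasi_transitive_separator:
  assumes qt: "\<And>x y w. (x, y) \<in> D \<Longrightarrow> (y, w) \<in> D \<Longrightarrow> x \<noteq> w \<Longrightarrow> (x, w) \<in> D \<or> (w, x) \<in> D"
    and sub: "z \<notin> S" "r \<notin> S" and rS: "\<And>s. s \<in> S \<Longrightarrow> (r, s) \<notin> D" and rz: "(r, z) \<in> D"
    and reach: "\<And>s. s \<in> S \<Longrightarrow> (z, s) \<in> (D \<inter> insert z S \<times> S)\<^sup>*"
    and s: "s \<in> S"
  shows "(z, s) \<in> D \<or> (s, z) \<in> D"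
proof -
  define E where "E = D \<inter> insert z S \<times> S"
  \<comment> \<open>Here \<open>n\<close> is the exact distance from \<open>z\<close> to
    \<open>s\<close> along \<open>E\<close>. At distance 1 the path \<open>r\<close>,
    \<open>z\<close>, \<open>s\<close> makes \<open>r\<close> and \<open>s\<close> adjacent, and
    only the arc from \<open>s\<close> to \<open>r\<close> is possible.\<close>
  have layer: "(even n \<longrightarrow> (s, z) \<in> D) \<and> (odd n \<longrightarrow> (s, r) \<in> D)"
    if "s \<in> S" "(z, s) \<in> E ^^ n" "\<And>m. m < n \<Longrightarrow> (z, s) \<notin> E ^^ m" for n s
    using that
  proof (induction n arbitrary: s rule: less_induct)
    case (less n)
    consider "n = 0" | "n = 1" | k where "n = Suc (Suc k)"
      by (metis One_nat_def not0_implies_Suc)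
    then show ?case
    proof cases
      case 1
      then show ?thesis using less.prems sub by auto
    next
      case 2
      then have "(z, s) \<in> D" using less.prems(2) by (auto simp: E_def)
      moreover have "r \<noteq> s" using less.prems(1) sub by auto
      ultimately show ?thesis using qt[OF rz, of s] rS[OF less.prems(1)] 2 by auto
    next
      case 3
      then obtain p q where pq: "(z, p) \<in> E ^^ k" "(p, q) \<in> E" "(q, s) \<in> E"
        using less.prems(2) by (auto elim!: relcompE)
      have "(p, s) \<notin> E"
        using less.prems(3)[of "Suc k"] pq(1) 3 by auto
      moreover have "p \<noteq> s" using less.prems(3)[of k] pq(1) 3 by auto
      ultimately have sp: "(s, p) \<in> D"
        using qt[of p q s] pq less.prems(1) unfolding E_def by blast
      show ?thesis
      proof (cases "k = 0")
        case True
        then show ?thesis using pq(1) sp 3 by auto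
      next
        case False
        then have pS: "p \<in> S"
          using pq(1) by (cases k) (auto simp: E_def)
        have short: "(z, p) \<notin> E ^^ m" if "m < k" for m
        proof
          assume "(z, p) \<in> E ^^ m"
          then have "(z, s) \<in> E ^^ Suc (Suc m)" using pq(2,3) by auto
          then show False using less.prems(3)[of "Suc (Suc m)"] that 3 by auto
        qed
        have IH: "(even k \<longrightarrow> (p, z) \<in> D) \<and> (odd k \<longrightarrow> (p, r) \<in> D)"
          by (rule less.IH[OF _ pS pq(1) short]) (use 3 in auto)
        have "(z, s) \<notin> D"
        proof
          assume "(z, s) \<in> D"
          then have "(z, s) \<in> E ^^ 1" using less.prems(1) by (auto simp: E_def)
          then show False using less.prems(3)[of 1] 3 by auto
        qed
        then show ?thesis
          using IH qt[OF sp, of z] qt[OF sp, of r] less.prems(1) sub rS 3 by auto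
      qed
    qed
  qed
  have "(z, s) \<in> E\<^sup>*" using reach[OF s] by (simp add: E_def)
  then obtain n where "(z, s) \<in> E ^^ n" by (auto simp: rtrancl_power)
  then obtain n where n: "(z, s) \<in> E ^^ n" "\<And>m. m < n \<Longrightarrow> (z, s) \<notin> E ^^ m"
    using exists_least_iff[of "\<lambda>n. (z, s) \<in> E ^^ n"] by blast
  \<comment> \<open>At odd distance, the arc from \<open>s\<close> to \<open>r\<close> followed by
    the arc from \<open>r\<close> to \<open>z\<close> makes \<open>s\<close> and \<open>z\<close>
    adjacent.\<close>
  show ?thesis
    using layer[OF s n] qt[OF _ rz, of s] s sub(1) by auto
qed

text \<open>By induction on \<open>card V\<close>, supposing that the non-adjacency graph is
  connected. A maximal proper vertex set \<open>W\<close> on which it stays connected omits a single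
  vertex \<open>z\<close>. Unless \<open>W\<close> is one point, it is not strongly connected, so it
  splits into \<open>R\<close> and \<open>S\<close> without arcs from \<open>R\<close> to
  \<open>S\<close>. Then \<open>quasi_transitive_separator\<close> makes \<open>z\<close> adjacent
  to all of \<open>W\<close>, although \<open>z\<close> has a non-neighbour there.\<close>

lemma quasi_transitive_not_connected:
  assumes "finite V" "card V \<ge> 2"
    and qt: "\<And>x y w. (x, y) \<in> D \<Longrightarrow> (y, w) \<in> D \<Longrightarrow> x \<noteq> w \<Longrightarrow> (x, w) \<in> D \<or> (w, x) \<in> D"
    and strong: "connected_on D V"
  shows "\<not> connected_on {(x, y). x \<noteq> y \<and> (x, y) \<notin> D \<and> (y, x) \<notin> D} V"
  using assms(1,2,4)
proof (induction "card V" arbitrary: V rule: less_induct)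
  case less
  let ?N = "{(x, y). x \<noteq> y \<and> (x, y) \<notin> D \<and> (y, x) \<notin> D}"
  show ?case
  proof
    assume conn: "connected_on ?N V"
    define F where "F = {W. W \<subset> V \<and> W \<noteq> {} \<and> connected_on ?N W}"
    have "finite F" unfolding F_def using less.prems(1) by (auto intro: finite_subset[of _ "Pow V"])
    moreover obtain v0 where "v0 \<in> V" using less.prems(2) by fastforce
    then have "{v0} \<in> F" using less.prems(2) by (auto simp: F_def connected_on_def)
    ultimately obtain W where W: "W \<in> F" and max: "\<And>U. U \<in> F \<Longrightarrow> W \<subseteq> U \<Longrightarrow> W = U"
      using finite_has_maximal2[of F "{v0}"] by blast
    have WV: "W \<subseteq> V" "W \<noteq> V" "W \<noteq> {}" and Wc: "connected_on ?N W" using W by (auto simp: F_def)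
    obtain w0 where w0: "w0 \<in> W" using WV by blast
    obtain v1 where v1: "v1 \<in> V" "v1 \<notin> W" using WV by blast
    have "(w0, v1) \<in> (?N \<inter> V \<times> V)\<^sup>*" using conn w0 v1 WV by (auto simp: connected_on_def)
    from rtrancl_crossing[OF this, of "- W"] w0(1) v1(2)
    obtain p z where "(p, z) \<in> ?N \<inter> V \<times> V" "p \<notin> - W" "z \<in> - W" by blast
    then have pz: "(p, z) \<in> ?N" "p \<in> W" "z \<in> V" "z \<notin> W" by simp_all
    have "connected_on ?N (insert z W)"
      unfolding connected_on_def
    proof (intro ballI)
      let ?R = "(?N \<inter> insert z W \<times> insert z W)\<^sup>*"
      have sub: "(?N \<inter> W \<times> W)\<^sup>* \<subseteq> ?R" by (intro rtrancl_mono) auto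
      have to: "(x, p) \<in> ?R \<and> (p, x) \<in> ?R" if "x \<in> insert z W" for x
      proof (cases "x = z")
        case True
        have "(p, z) \<in> ?N \<inter> insert z W \<times> insert z W" "(z, p) \<in> ?N \<inter> insert z W \<times> insert z W"
          using pz by auto
        then show ?thesis using True by blast
      next
        case False
        then show ?thesis using that Wc pz(2) sub unfolding connected_on_def by blast
      qed
      fix x y assume "x \<in> insert z W" "y \<in> insert z W"
      then show "(x, y) \<in> ?R" using to by (meson rtrancl_trans)
    qed
    then have V: "V = insert z W"
      using max[of "insert z W"] pz WV unfolding F_def by blast
    have adj: "\<exists>v\<in>W. (z, v) \<in> ?N"
    proof -
      have "(z, p) \<in> ?N" using pz by auto
      then show ?thesis using pz by blast
    qed
    have cardW: "card V = Suc (card W)" using V pz(4) less.prems(1) by auto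
    have finW: "finite W" using less.prems(1) V by simp
    show False
    proof (cases "card W \<ge> 2")
      case False
      then have "card W = 1" using cardW less.prems(2) by simp
      then have "W = {w0}" using w0 by (auto simp: card_1_singleton_iff)
      then have Vzw: "V = {z, w0}" "z \<noteq> w0" using V pz by auto
      have "(z, w0) \<in> (D \<inter> V \<times> V)\<^sup>*" using less.prems(3) Vzw(1) by (simp add: connected_on_def)
      from rtrancl_crossing[OF this, of "{w0}"] Vzw have "(z, w0) \<in> D" by auto
      then show False using adj \<open>W = {w0}\<close> by auto
    next
      case True
      then have "\<not> connected_on D W"
        using less.hyps[OF _ finW True] Wc cardW by auto
      then obtain a b where ab: "a \<in> W" "b \<in> W" "(a, b) \<notin> (D \<inter> W \<times> W)\<^sup>*"
        by (auto simp: connected_on_def)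
      define R where "R = {v \<in> W. (a, v) \<in> (D \<inter> W \<times> W)\<^sup>*}"
      define S where "S = W - R"
      have aR: "a \<in> R" and bS: "b \<in> S" using ab by (auto simp: R_def S_def)
      have noRS: "(u, v) \<notin> D" if "u \<in> R" "v \<in> S" for u v
      proof
        assume "(u, v) \<in> D"
        then have "(a, v) \<in> (D \<inter> W \<times> W)\<^sup>*"
          using that unfolding R_def S_def by (auto intro: rtrancl_into_rtrancl)
        then show False using that by (auto simp: R_def S_def)
      qed
      have strongV: "(u, v) \<in> (D \<inter> V \<times> V)\<^sup>*" if "u \<in> V" "v \<in> V" for u v
        using less.prems(3) that by (auto simp: connected_on_def)
      have RSV: "R \<subseteq> V" "S \<subseteq> V" "z \<notin> R" "z \<notin> S" "V = insert z (R \<union> S)" "R \<inter> S = {}"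
        using V pz(4) by (auto simp: R_def S_def)
      obtain r0 where r0: "r0 \<in> R" "(r0, z) \<in> D"
      proof -
        have "(a, b) \<in> (D \<inter> V \<times> V)\<^sup>*" "a \<notin> - R" "b \<in> - R"
          using strongV aR bS RSV by (blast, blast, blast)
        from rtrancl_crossing[OF this] obtain p q
          where pq: "(p, q) \<in> D" "q \<in> V" "p \<in> R" "q \<notin> R" by blast
        then have "q = z" using noRS RSV(5) by blast
        then show ?thesis using that pq by blast
      qed
      obtain s0 where s0: "s0 \<in> S" "(z, s0) \<in> D"
      proof -
        have "(a, b) \<in> (D \<inter> V \<times> V)\<^sup>*" "a \<notin> S" "b \<in> S"
          using strongV aR bS RSV by (blast, blast, blast)
        from rtrancl_crossing[OF this] obtain p q
          where pq: "(p, q) \<in> D" "p \<in> V" "p \<notin> S" "q \<in> S" by blast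
        then have "p = z" using noRS RSV(5) by blast
        then show ?thesis using that pq by blast
      qed
      \<comment> \<open>\<open>S\<close> can be entered only from \<open>z\<close>, so strong
        connectivity yields walks from \<open>z\<close> that never leave \<open>S\<close>
        again.\<close>
      have reachS: "(z, s) \<in> (D \<inter> insert z S \<times> S)\<^sup>*" if "s \<in> S" for s
      proof (rule ccontr)
        let ?E = "(D \<inter> insert z S \<times> S)\<^sup>*"
        assume n: "(z, s) \<notin> ?E"
        have "(z, s) \<in> (D \<inter> V \<times> V)\<^sup>*" "z \<notin> {s \<in> S. (z, s) \<notin> ?E}" "s \<in> {s \<in> S. (z, s) \<notin> ?E}"
          using strongV[of z s] RSV(2,5) that n by (blast, simp, simp)
        from rtrancl_crossing[OF this] obtain p q where pq: "(p, q) \<in> D" "p \<in> V"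
          "p \<in> S \<Longrightarrow> (z, p) \<in> ?E" "q \<in> S" "(z, q) \<notin> ?E" by blast
        have p: "p \<in> insert z S" using noRS[of p q] pq(1,2,4) RSV(5) by blast
        then have "(z, p) \<in> ?E" using pq(3) by blast
        moreover have "(p, q) \<in> D \<inter> insert z S \<times> S" using p pq(1,4) by blast
        ultimately have "(z, q) \<in> ?E" by (rule rtrancl_into_rtrancl)
        then show False using pq(5) by contradiction
      qed
      have reachR: "(z, s) \<in> (D\<inverse> \<inter> insert z R \<times> R)\<^sup>*" if "s \<in> R" for s
      proof (rule ccontr)
        let ?E = "(D\<inverse> \<inter> insert z R \<times> R)\<^sup>*"
        assume n: "(z, s) \<notin> ?E"
        have "(s, z) \<in> (D \<inter> V \<times> V)\<^sup>*" "s \<notin> - {s \<in> R. (z, s) \<notin> ?E}" "z \<in> - {s \<in> R. (z, s) \<notin> ?E}"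
          using strongV[of s z] RSV(1,5) that n by (blast, simp, simp)
        from rtrancl_crossing[OF this] obtain p q where pq: "(p, q) \<in> D" "q \<in> V"
          "q \<in> R \<Longrightarrow> (z, q) \<in> ?E" "p \<in> R" "(z, p) \<notin> ?E" by blast
        have q: "q \<in> insert z R" using noRS[of p q] pq(1,2,4) RSV(5) by blast
        then have "(z, q) \<in> ?E" using pq(3) by blast
        moreover have "(q, p) \<in> D\<inverse> \<inter> insert z R \<times> R" using q pq(1,4) by blast
        ultimately have "(z, p) \<in> ?E" by (rule rtrancl_into_rtrancl)
        then show False using pq(5) by contradiction
      qed
      have "(z, s) \<in> D \<or> (s, z) \<in> D" if "s \<in> S" for s
        by (rule quasi_transitive_separator[OF qt RSV(4) _ noRS r0(2) reachS that])
          (use r0 RSV in auto)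
      \<comment> \<open>Reversing all arcs exchanges the roles of \<open>R\<close> and
        \<open>S\<close>, with \<open>s0\<close> in place of \<open>r0\<close>.\<close>
      moreover have "(z, s) \<in> D\<inverse> \<or> (s, z) \<in> D\<inverse>" if "s \<in> R" for s
      proof (rule quasi_transitive_separator[where r = s0])
        show "(x, w) \<in> D\<inverse> \<or> (w, x) \<in> D\<inverse>" if "(x, y) \<in> D\<inverse>" "(y, w) \<in> D\<inverse>" "x \<noteq> w" for x y w
          using qt[of w y x] that by auto
      qed (use RSV s0 noRS reachR that in auto)
      moreover obtain v where "v \<in> W" "(z, v) \<in> ?N" using adj by blast
      moreover have "W = R \<union> S" by (auto simp: R_def S_def)
      ultimately show False by auto
    qed
  qed
qed

section \<open>Coherent closure and good sets\<close>

text \<open>The coarsest coherent refinement of \<open>c\<close> identifies two pairs if they are linked by a chain of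
  pairs, each having the same colour as the next in some coherent refinement.\<close>
definition closure_step :: "'a set \<Rightarrow> ('a \<Rightarrow> 'a \<Rightarrow> 'c) \<Rightarrow> (('a \<times> 'a) \<times> 'a \<times> 'a) set" where
  "closure_step V c = {((x, y), (u, v)). x \<in> V \<and> y \<in> V \<and> u \<in> V \<and> v \<in> V \<and>
     (\<exists>d :: 'a \<Rightarrow> 'a \<Rightarrow> ('a \<times> 'a) set. coherent V d \<and> refines V d c \<and> d x y = d u v)}"

definition closure_colour :: "'a set \<Rightarrow> ('a \<Rightarrow> 'a \<Rightarrow> 'c) \<Rightarrow> 'a \<Rightarrow> 'a \<Rightarrow> ('a \<times> 'a) set" where
  "closure_colour V c x y = (closure_step V c)\<^sup>* `` {(x, y)}"

lemma sym_closure_step: "sym (closure_step V c)"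
  unfolding closure_step_def sym_def by (auto; metis)

lemma closure_colour_eq_iff:
  "closure_colour V c x y = closure_colour V c u v \<longleftrightarrow> ((x, y), (u, v)) \<in> (closure_step V c)\<^sup>*"
proof
  assume "closure_colour V c x y = closure_colour V c u v"
  then have "(u, v) \<in> closure_colour V c x y" by (auto simp: closure_colour_def)
  then show "((x, y), (u, v)) \<in> (closure_step V c)\<^sup>*" by (simp add: closure_colour_def)
next
  assume *: "((x, y), (u, v)) \<in> (closure_step V c)\<^sup>*"
  then have "((u, v), (x, y)) \<in> (closure_step V c)\<^sup>*"
    using sym_rtrancl[OF sym_closure_step] by (meson symD)
  with * show "closure_colour V c x y = closure_colour V c u v"
    unfolding closure_colour_def by (auto intro: rtrancl_trans)
qed

lemma closure_step_induct:
  assumes "closure_colour V c x y = closure_colour V c u v"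
    and step: "\<And>a b a' b'. ((a, b), (a', b')) \<in> closure_step V c \<Longrightarrow> f a b = f a' b'"
  shows "f x y = f u v"
proof -
  have "((x, y), (u, v)) \<in> (closure_step V c)\<^sup>*" using assms(1) by (simp add: closure_colour_eq_iff)
  then have "case_prod f (x, y) = case_prod f (u, v)"
  proof (induction rule: rtrancl_induct)
    case (step p q)
    then show ?case using assms(2)[of "fst p" "snd p" "fst q" "snd q"] by (simp add: case_prod_beta)
  qed simp
  then show ?thesis by simp
qed

lemma closure_colour_coarsest:
  fixes d :: "'a \<Rightarrow> 'a \<Rightarrow> ('a \<times> 'a) set"
  assumes "coherent V d" "refines V d c"
  shows "refines V d (closure_colour V c)"
  unfolding refines_def
proof (intro ballI impI)
  fix x y u v assume "x \<in> V" "y \<in> V" "u \<in> V" "v \<in> V" "d x y = d u v"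
  then have "((x, y), (u, v)) \<in> closure_step V c" using assms unfolding closure_step_def by auto
  then show "closure_colour V c x y = closure_colour V c u v"
    unfolding closure_colour_eq_iff by (rule r_into_rtrancl)
qed

lemma refines_closure_colour: "refines V (closure_colour V c) c"
  unfolding refines_def
proof (intro ballI impI)
  fix x y u v assume "closure_colour V c x y = closure_colour V c u v"
  then show "c x y = c u v"
    by (rule closure_step_induct) (auto simp: closure_step_def refines_def)
qed

text \<open>Each clause of coherence is checked along a single step and then follows along chains.
  The colouring \<open>d\<close> behind a step refines the closure, so counts of paths with
  prescribed closure colours agree by \<open>coherent_card\<close> applied to
  \<open>d\<close>.\<close>

lemma coherent_closure_colour:
  assumes fin: "finite V"
  shows "coherent V (closure_colour V c)"
  unfolding coherent_def
proof (intro conjI ballI impI allI)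
  show "finite V" by (rule fin)
next
  fix x y z assume V: "x \<in> V" "y \<in> V" "z \<in> V" and eq: "closure_colour V c x x = closure_colour V c y z"
  have "(x = x) = (y = z)"
    by (rule closure_step_induct[OF eq]) (auto simp: closure_step_def dest: coherent_diag coherent_diag[OF _ sym])
  then show "y = z" by simp
next
  fix x y u v assume V: "x \<in> V" "y \<in> V" "u \<in> V" "v \<in> V" and eq: "closure_colour V c x y = closure_colour V c u v"
  show "closure_colour V c y x = closure_colour V c v u"
  proof (rule closure_step_induct[OF eq])
    fix a b a' b' assume "((a, b), (a', b')) \<in> closure_step V c"
    then have "((b, a), (b', a')) \<in> closure_step V c"
      unfolding closure_step_def by (blast dest: coherent_converse)
    then show "closure_colour V c b a = closure_colour V c b' a'"
      unfolding closure_colour_eq_iff by (rule r_into_rtrancl)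
  qed
next
  fix x y u v i j assume V: "x \<in> V" "y \<in> V" "u \<in> V" "v \<in> V" and eq: "closure_colour V c x y = closure_colour V c u v"
  let ?k = "closure_colour V c"
  show "card {z\<in>V. ?k x z = i \<and> ?k z y = j} = card {z\<in>V. ?k u z = i \<and> ?k z v = j}"
  proof (rule closure_step_induct[OF eq])
    fix a b a' b' assume "((a, b), (a', b')) \<in> closure_step V c"
    then obtain d :: "'a \<Rightarrow> 'a \<Rightarrow> ('a \<times> 'a) set" where d: "coherent V d" "refines V d c" "d a b = d a' b'"
      and ab: "a \<in> V" "b \<in> V" "a' \<in> V" "b' \<in> V"
      unfolding closure_step_def by auto
    have k: "refines V d ?k" by (rule closure_colour_coarsest[OF d(1,2)])
    show "card {z\<in>V. ?k a z = i \<and> ?k z b = j} = card {z\<in>V. ?k a' z = i \<and> ?k z b' = j}"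
      using refinesD[OF coherent_card[OF d(1) refines_comp[OF k, of "\<lambda>t. t = i"] refines_comp[OF k, of "\<lambda>t. t = j"]] d(3)] ab
      by blast
  qed
qed

text \<open>Every coherent refinement of \<open>c\<close> already refines its closure. An arbitrary
  colouring may thus be replaced by a coherent one whose colours have the type that occurs in
  \<open>good\<close>.\<close>

lemma good_closure_colour:
  assumes "good V (closure_colour V c) D" shows "good V c D"
  using assms closure_colour_coarsest unfolding good_def by blast

lemma fibre_union_complement: "fibre_union V d D \<longleftrightarrow> fibre_union V d (V - D)"
  unfolding fibre_union_def by blast

lemma good_complement: "good V c D \<Longrightarrow> good V c (V - D)"
  unfolding good_def using fibre_union_complement by fastforce

lemma good_inj_on:
  assumes "good V c D" "coherent V d" "refines V d c" "fibre_union V d D"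
  shows "inj_on (\<lambda>x. (d :: 'a \<Rightarrow> 'a \<Rightarrow> ('a \<times> 'a) set) x x) V"
  using assms unfolding good_def by blast

section \<open>Half systems and the parity of homogeneous configurations\<close>

definition conv :: "'a set \<Rightarrow> ('a \<Rightarrow> 'a \<Rightarrow> 'c) \<Rightarrow> 'c \<Rightarrow> 'c" where
  "conv V c a = (SOME b. \<exists>x\<in>V. \<exists>y\<in>V. c x y = a \<and> c y x = b)"

lemma conv_eq: "coherent V c \<Longrightarrow> x \<in> V \<Longrightarrow> y \<in> V \<Longrightarrow> conv V c (c x y) = c y x"
  unfolding conv_def by (rule some_equality) (auto dest: coherent_converse)

text \<open>\<open>rep\<close> picks one colour from each unordered pair of converse colours, which
  are distinct by antisymmetry. The complement of a half system is again one, so the colour of one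
  given pair can be forced into it.\<close>

lemma ex_half_system:
  fixes c :: "'a \<Rightarrow> 'a \<Rightarrow> 'c"
  assumes c: "coherent V c" and a: "antisymmetric V c" and rV: "p \<in> V" "q \<in> V" "p \<noteq> q"
  shows "\<exists>P. c p q \<in> P \<and> (\<forall>x\<in>V. \<forall>y\<in>V. x \<noteq> y \<longrightarrow> (c x y \<in> P \<longleftrightarrow> c y x \<notin> P))"
proof -
  define rep where "rep S = (SOME s. s \<in> S)" for S :: "'c set"
  define P where "P = {t. rep {t, conv V c t} = t}"
  have P: "c x y \<in> P \<longleftrightarrow> c y x \<notin> P" if V: "x \<in> V" "y \<in> V" "x \<noteq> y" for x y
  proof -
    have ne: "c x y \<noteq> c y x" using a V unfolding antisymmetric_def by blast
    have mem: "rep {c x y, c y x} \<in> {c x y, c y x}" unfolding rep_def by (rule someI[of _ "c x y"]) simp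
    have eq: "e \<in> {s, t} \<Longrightarrow> s \<noteq> t \<Longrightarrow> e = s \<longleftrightarrow> e \<noteq> t" for e s t :: 'c by auto
    have "c x y \<in> P \<longleftrightarrow> rep {c x y, c y x} = c x y"
      unfolding P_def conv_eq[OF c V(1,2)] mem_Collect_eq ..
    moreover have "c y x \<in> P \<longleftrightarrow> rep {c x y, c y x} = c y x"
      unfolding P_def conv_eq[OF c V(2,1)] mem_Collect_eq insert_commute[of "c y x"] ..
    ultimately show ?thesis using eq[OF mem ne] by blast
  qed
  show ?thesis
  proof (cases "c p q \<in> P")
    case True
    then show ?thesis using P by blast
  next
    case False
    then have "c p q \<in> - P \<and> (\<forall>x\<in>V. \<forall>y\<in>V. x \<noteq> y \<longrightarrow> (c x y \<in> - P \<longleftrightarrow> c y x \<notin> - P))"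
      using P by blast
    then show ?thesis by (rule exI)
  qed
qed

lemma sum_degree_converse:
  assumes "finite V"
  shows "(\<Sum>x\<in>V. card {y\<in>V. R x y}) = (\<Sum>x\<in>V. card {y\<in>V. R y x})"
proof -
  have "(\<Sum>x\<in>V. card {y\<in>V. R x y}) = (\<Sum>x\<in>V. \<Sum>y\<in>V. if R x y then 1 else 0)"
    using assms by (simp add: sum.If_cases Int_def)
  also have "\<dots> = (\<Sum>y\<in>V. \<Sum>x\<in>V. if R x y then 1 else 0)" by (rule sum.swap)
  also have "\<dots> = (\<Sum>x\<in>V. card {y\<in>V. R y x})"
    using assms by (simp add: sum.If_cases Int_def)
  finally show ?thesis .
qed

lemma coherent_refines_eq:
  assumes c: "coherent V c" shows "refines V c (\<lambda>x y. x = y)"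
  unfolding refines_def
proof (intro ballI impI)
  fix x y u v assume V: "x \<in> V" "y \<in> V" "u \<in> V" "v \<in> V" and eq: "c x y = c u v"
  show "(x = y) = (u = v)"
    using coherent_diag[OF c, of x u v] coherent_diag[OF c, of u x y] V eq by auto
qed

definition homogeneous :: "'a set \<Rightarrow> ('a \<Rightarrow> 'a \<Rightarrow> 'c) \<Rightarrow> bool" where
  "homogeneous V c \<longleftrightarrow> (\<forall>x\<in>V. \<forall>y\<in>V. c x x = c y y)"

lemma homogeneous_degree:
  assumes "coherent V c" "homogeneous V c" "refines V c P" "x \<in> V" "y \<in> V"
  shows "card {z\<in>V. P x z} = card {z\<in>V. P y z}"
  using coherent_degree[OF assms(1,3)] assms(2,4,5) unfolding homogeneous_def by blast

lemma refines_swap: "refines V d c \<Longrightarrow> refines V (\<lambda>x y. d y x) (\<lambda>x y. c y x)"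
  unfolding refines_def by blast

text \<open>Out-degrees and in-degrees are both constant, and both sum to the number of pairs in
  \<open>P\<close>.\<close>

lemma homogeneous_degree_converse:
  assumes c: "coherent V c" and h: "homogeneous V c" and P: "refines V c P" and V: "x \<in> V" "y \<in> V"
  shows "card {z\<in>V. P x z} = card {z\<in>V. P z y}"
proof -
  have fin: "finite V" using c by (rule coherent_finite)
  have P': "refines V c (\<lambda>x y. P y x)"
    by (rule refines_trans[OF refines_converse[OF c] refines_swap[OF P]])
  have s1: "(\<Sum>u\<in>V. card {z\<in>V. P u z}) = card V * card {z\<in>V. P x z}"
    using homogeneous_degree[OF c h P _ V(1)] by simp
  have s2: "(\<Sum>u\<in>V. card {z\<in>V. P z u}) = card V * card {z\<in>V. P z y}"
    using homogeneous_degree[OF c h P' _ V(2)] by simp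
  have "card V * card {z\<in>V. P x z} = card V * card {z\<in>V. P z y}"
    unfolding s1[symmetric] s2[symmetric] by (rule sum_degree_converse[OF fin])
  moreover have "card V \<noteq> 0" using V(1) fin by auto
  ultimately show ?thesis by simp
qed

text \<open>A half system divides the points other than \<open>p\<close> into out-neighbours and
  in-neighbours of \<open>p\<close>, and the two parts are equally large.\<close>

lemma odd_card_homogeneous:
  assumes c: "coherent V c" and a: "antisymmetric V c" and h: "homogeneous V c" and ne: "V \<noteq> {}"
  shows "odd (card V)"
proof (cases "\<exists>p\<in>V. \<exists>q\<in>V. p \<noteq> q")
  case False
  then obtain p where "V = {p}" using ne by blast
  then show ?thesis by simp
next
  case True
  then obtain p q where pq: "p \<in> V" "q \<in> V" "p \<noteq> q" by blast
  obtain P where "c p q \<in> P"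
    and P: "\<forall>x\<in>V. \<forall>y\<in>V. x \<noteq> y \<longrightarrow> (c x y \<in> P \<longleftrightarrow> c y x \<notin> P)"
    using ex_half_system[OF c a pq] by (elim exE conjE)
  have fin: "finite V" using c by (rule coherent_finite)
  let ?Q = "\<lambda>x y. x \<noteq> y \<and> c x y \<in> P"
  have neq: "refines V c (\<lambda>x y. x \<noteq> y)"
    using refines_comp[OF coherent_refines_eq[OF c], of Not] .
  have Q: "refines V c ?Q"
    using refines_comp2[OF neq refines_refl, of "\<lambda>s t. s \<and> t \<in> P"] .
  have Qp: "z = p \<and> \<not> ?Q p z \<and> \<not> ?Q z p \<or> z \<noteq> p \<and> ?Q p z \<noteq> ?Q z p" if "z \<in> V" for z
    by (cases "z = p") (use P[rule_format, OF pq(1) that] in auto)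
  have "V = insert p ({z\<in>V. ?Q p z} \<union> {z\<in>V. ?Q z p})"
  proof (rule Set.set_eqI)
    show "z \<in> V \<longleftrightarrow> z \<in> insert p ({z\<in>V. ?Q p z} \<union> {z\<in>V. ?Q z p})" for z
      using Qp[of z] pq(1) by auto
  qed
  moreover have "{z\<in>V. ?Q p z} \<inter> {z\<in>V. ?Q z p} = {}" using Qp by blast
  then have "card (insert p ({z\<in>V. ?Q p z} \<union> {z\<in>V. ?Q z p}))
      = Suc (card {z\<in>V. ?Q p z} + card {z\<in>V. ?Q z p})"
    using fin by (subst card_insert_disjoint) (simp_all add: card_Un_disjoint)
  ultimately have "card V = Suc (card {z\<in>V. ?Q p z} + card {z\<in>V. ?Q z p})" by presburger
  then show ?thesis
    using homogeneous_degree_converse[OF c h Q pq(1,1)] by simp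
qed

text \<open>Either \<open>D\<close> or its complement will do; an odd number of points excludes a
  tie.\<close>

lemma good_majority:
  assumes D: "good V c D" and odd: "odd (card V)" and fin: "finite V"
  shows "\<exists>G. good V c G \<and> card V < 2 * card G"
proof (cases "card V < 2 * card D")
  case True
  then show ?thesis using D by blast
next
  case False
  have "D \<subseteq> V" using D by (simp add: good_def)
  then have "card (V - D) = card V - card D" "card D \<le> card V"
    using fin by (auto simp: card_Diff_subset finite_subset card_mono)
  moreover have "2 * card D \<noteq> card V" using odd by (metis dvd_triv_left)
  ultimately have "card V < 2 * card (V - D)" using False by linarith
  then show ?thesis using good_complement[OF D] by blast
qed

section \<open>Primitive configurations\<close>

text \<open>All in-degrees equal \<open>e\<close>, so the out-degrees have average \<open>e\<close>;
  by asymmetry the two degrees of a vertex add up to at most \<open>card I - 1\<close>.\<close>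

lemma asymmetric_in_degree:
  assumes "finite I" "I \<noteq> {}" and deg: "\<And>v. v \<in> I \<Longrightarrow> card {z\<in>I. R z v} = e"
    and asym: "\<And>z v. z \<in> I \<Longrightarrow> v \<in> I \<Longrightarrow> R z v \<Longrightarrow> \<not> R v z"
  shows "2 * e + 1 \<le> card I"
proof -
  have pos: "card I > 0" using assms(1,2) by (simp add: card_gt_0_iff)
  have "card {z\<in>I. R v z} + card {z\<in>I. R z v} \<le> card I - 1" if v: "v \<in> I" for v
  proof -
    have "{z\<in>I. R v z} \<inter> {z\<in>I. R z v} = {}" using asym v by blast
    then have "card {z\<in>I. R v z} + card {z\<in>I. R z v} = card ({z\<in>I. R v z} \<union> {z\<in>I. R z v})"
      using assms(1) by (simp add: card_Un_disjoint)
    also have "{z\<in>I. R v z} \<union> {z\<in>I. R z v} \<subseteq> I - {v}" using asym[OF v v] by blast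
    then have "card ({z\<in>I. R v z} \<union> {z\<in>I. R z v}) \<le> card (I - {v})"
      using assms(1) by (intro card_mono) auto
    finally show ?thesis using v assms(1) by simp
  qed
  then have "(\<Sum>v\<in>I. card {z\<in>I. R v z} + card {z\<in>I. R z v}) \<le> (\<Sum>v\<in>I. card I - 1)"
    by (rule sum_mono)
  moreover have "(\<Sum>v\<in>I. card {z\<in>I. R v z}) = card I * e"
    using sum_degree_converse[OF assms(1), of R] deg by simp
  moreover have "(\<Sum>v\<in>I. card {z\<in>I. R z v}) = card I * e" using deg by simp
  ultimately have "card I * (2 * e) \<le> card I * (card I - 1)"
    by (simp add: sum.distrib algebra_simps)
  then have "2 * e \<le> card I - 1" using pos by (simp only: mult_le_cancel1)
  then show ?thesis using pos by simp
qed

text \<open>With \<open>t = c u u'\<close>, by asymmetry fewer than half of the in-neighbours of \<open>u\<close> for \<open>t\<close> are also in-neighbours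
  of \<open>u'\<close>, and likewise for out-neighbours; so more than \<open>deg t\<close> points separate \<open>u\<close> from \<open>u'\<close>.\<close>
lemma minimal_degree_separated:
  assumes c: "coherent V c" and a: "antisymmetric V c" and h: "homogeneous V c"
    and V: "x \<in> V" "u \<in> V" "u' \<in> V" and ne: "u \<noteq> u'"
    and min: "card {z\<in>V. c x z = r} \<le> card {z\<in>V. c x z = c u u'}"
  shows "\<exists>z\<in>V. c x z \<noteq> r \<and> c z u \<noteq> c z u'"
proof -
  define t where "t = c u u'"
  define n where "n = card {z\<in>V. c x z = t}"
  have fin: "finite V" using c by (rule coherent_finite)
  have asym: "\<not> c v z = t" if "c z v = t" "z \<in> V" "v \<in> V" for z v
  proof
    assume "c v z = t"
    then have "z = v" using a that unfolding antisymmetric_def by metis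
    then show False using that coherent_diag[OF c, of v u u'] V ne by (auto simp: t_def)
  qed
  have t: "refines V c (\<lambda>p q. c p q = t)"
    using refines_comp[OF refines_refl, of V c "\<lambda>s. s = t"] .
  have t': "refines V c (\<lambda>p q. c q p = t)"
    using refines_comp[OF refines_converse[OF c], of "\<lambda>s. s = t"] .
  define e1 where "e1 = card {z\<in>V. c z u = t \<and> c z u' = t}"
  define e2 where "e2 = card {z\<in>V. c u z = t \<and> c u' z = t}"
  have outn: "card {z\<in>V. c w z = t} = n" if "w \<in> V" for w
    unfolding n_def by (rule homogeneous_degree[OF c h t that V(1)])
  have inn: "card {z\<in>V. c z w = t} = n" if "w \<in> V" for w
    using homogeneous_degree_converse[OF c h t that that] outn[OF that] by simp
  \<comment> \<open>Each \<open>v\<close> in this in-neighbourhood of \<open>u'\<close> satisfies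
    \<open>c v u' = c u u'\<close>, so inside the in-neighbourhood the relation of colour
    \<open>t\<close> has constant in-degree \<open>e1\<close>.\<close>
  have "2 * e1 + 1 \<le> card {z\<in>V. c z u' = t}"
  proof (rule asymmetric_in_degree[where R = "\<lambda>z v. c z v = t"])
    show "{z\<in>V. c z u' = t} \<noteq> {}" using V by (auto simp: t_def)
    fix v assume v: "v \<in> {z\<in>V. c z u' = t}"
    then have "card {z\<in>V. c z v = t \<and> c z u' = t} = e1"
      using refinesD[OF coherent_card[OF c t' t], of v u' u u'] V by (auto simp: e1_def t_def)
    then show "card {z \<in> {z\<in>V. c z u' = t}. c z v = t} = e1"
      by (simp add: conj_ac)
  qed (use fin asym in auto)
  then have e1: "2 * e1 + 1 \<le> n" using inn[OF V(3)] by simp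
  have "2 * e2 + 1 \<le> card {z\<in>V. c u z = t}"
  proof (rule asymmetric_in_degree[where R = "\<lambda>z v. c v z = t"])
    show "{z\<in>V. c u z = t} \<noteq> {}" using V by (auto simp: t_def)
    fix v assume v: "v \<in> {z\<in>V. c u z = t}"
    then have "card {z\<in>V. c u z = t \<and> c v z = t} = e2"
      using refinesD[OF coherent_card[OF c t t'], of u v u u'] V by (auto simp: e2_def t_def)
    then show "card {z \<in> {z\<in>V. c u z = t}. c v z = t} = e2"
      by (simp add: conj_ac)
  qed (use fin asym in auto)
  then have e2: "2 * e2 + 1 \<le> n" using outn[OF V(2)] by simp
  \<comment> \<open>All points of both sets separate \<open>u\<close> from \<open>u'\<close>. The
    sets are disjoint and each has more than half of \<open>n\<close> points, so their union does
    not fit into the piece of \<open>r\<close>, which has at most \<open>n\<close>.\<close>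
  let ?X1 = "{z\<in>V. c z u = t} - {z\<in>V. c z u = t \<and> c z u' = t}"
  let ?X2 = "{z\<in>V. c u z = t} - {z\<in>V. c u z = t \<and> c u' z = t}"
  have X1: "card ?X1 = n - e1"
    by (subst card_Diff_subset) (use fin inn[OF V(2)] in \<open>auto simp: e1_def\<close>)
  have X2: "card ?X2 = n - e2"
    by (subst card_Diff_subset) (use fin outn[OF V(2)] in \<open>auto simp: e2_def\<close>)
  have "?X1 \<inter> ?X2 = {}" using asym V(2) by blast
  then have "card (?X1 \<union> ?X2) = card ?X1 + card ?X2"
    using fin by (intro card_Un_disjoint) auto
  then have big: "card (?X1 \<union> ?X2) > card {z\<in>V. c x z = r}"
    using e1 e2 X1 X2 min by (simp add: n_def t_def)
  have "\<not> ?X1 \<union> ?X2 \<subseteq> {z\<in>V. c x z = r}"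
  proof
    assume "?X1 \<union> ?X2 \<subseteq> {z\<in>V. c x z = r}"
    then have "card (?X1 \<union> ?X2) \<le> card {z\<in>V. c x z = r}"
      by (rule card_mono[rotated]) (use fin in auto)
    then show False using big by simp
  qed
  then obtain z where z: "z \<in> ?X1 \<union> ?X2" "c x z \<noteq> r" by blast
  have "c z u \<noteq> c z u'"
  proof
    assume eq: "c z u = c z u'"
    have zV: "z \<in> V" using z(1) by blast
    show False
    proof (cases "z \<in> ?X1")
      case True
      then show False using eq by auto
    next
      case False
      then have "c u z = t" "c u' z \<noteq> t" using z(1) by auto
      then show False using coherent_converse[OF c eq zV V(2) zV V(3)] by simp
    qed
  qed
  then show ?thesis using z by blast
qed

section \<open>Primitivity, strong connectivity and levels of colours\<close>

definition primitive :: "'a set \<Rightarrow> ('a \<Rightarrow> 'a \<Rightarrow> 'c) \<Rightarrow> bool" where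
  "primitive V c \<longleftrightarrow> (\<forall>e. equiv V e \<longrightarrow> refines V c (\<lambda>x y. (x, y) \<in> e) \<longrightarrow> e = Id_on V \<or> e = V \<times> V)"

lemma refines_rtrancl:
  assumes c: "coherent V c" and E: "refines V c (\<lambda>x y. (x, y) \<in> E)" "E \<subseteq> V \<times> V"
  shows "refines V c (\<lambda>x y. (x, y) \<in> E\<^sup>*)"
proof -
  have n: "refines V c (\<lambda>x y. (x, y) \<in> E ^^ n)" for n
  proof (induction n)
    case 0
    then show ?case using coherent_refines_eq[OF c] by simp
  next
    case (Suc n)
    have "(\<lambda>x y. (x, y) \<in> E ^^ Suc n) = (\<lambda>x y. \<exists>z\<in>V. (x, z) \<in> E ^^ n \<and> (z, y) \<in> E)"
      using E(2) by (auto simp: fun_eq_iff)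
    then show ?case using coherent_relcomp[OF c Suc E(1)] by simp
  qed
  show ?thesis
    unfolding refines_def
  proof (intro ballI impI)
    fix x y u v assume V: "x \<in> V" "y \<in> V" "u \<in> V" "v \<in> V" and eq: "c x y = c u v"
    show "((x, y) \<in> E\<^sup>*) = ((u, v) \<in> E\<^sup>*)"
      unfolding rtrancl_power using refinesD[OF n eq V] by simp
  qed
qed

lemma equiv_rtrancl:
  assumes "E \<subseteq> V \<times> V" "sym (E\<^sup>* \<inter> V \<times> V)"
  shows "equiv V (E\<^sup>* \<inter> V \<times> V)"
proof (intro equivI)
  show "trans (E\<^sup>* \<inter> V \<times> V)" by (rule transI) (blast intro: rtrancl_trans)
qed (use assms(2) in \<open>auto simp: refl_on_def\<close>)

text \<open>In a homogeneous configuration the reachability sets all have the same size.\<close>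
lemma sym_reachability:
  assumes c: "coherent V c" and h: "homogeneous V c" and E: "refines V c (\<lambda>x y. (x, y) \<in> E)" "E \<subseteq> V \<times> V"
  shows "sym (E\<^sup>* \<inter> V \<times> V)"
proof (rule symI)
  fix x y assume xy: "(x, y) \<in> E\<^sup>* \<inter> V \<times> V"
  have fin: "finite V" using c by (rule coherent_finite)
  have sub: "{z\<in>V. (y, z) \<in> E\<^sup>*} \<subseteq> {z\<in>V. (x, z) \<in> E\<^sup>*}"
    using xy by (auto intro: rtrancl_trans)
  have "card {z\<in>V. (y, z) \<in> E\<^sup>*} = card {z\<in>V. (x, z) \<in> E\<^sup>*}"
    using xy by (intro homogeneous_degree[OF c h refines_rtrancl[OF c E]]) simp_all
  then have "{z\<in>V. (y, z) \<in> E\<^sup>*} = {z\<in>V. (x, z) \<in> E\<^sup>*}"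
    using card_subset_eq[OF _ sub] fin by simp
  moreover have "x \<in> {z\<in>V. (x, z) \<in> E\<^sup>*}" using xy by simp
  ultimately have "x \<in> {z\<in>V. (y, z) \<in> E\<^sup>*}" by simp
  then show "(y, x) \<in> E\<^sup>* \<inter> V \<times> V" using xy by simp
qed

text \<open>Reachability along \<open>E\<close> is an equivalence relation of the configuration by
  \<open>sym_reachability\<close>. It is not the diagonal, so primitivity makes it
  everything.\<close>

lemma primitive_connected:
  assumes c: "coherent V c" and h: "homogeneous V c" and prim: "primitive V c"
    and E: "refines V c (\<lambda>x y. (x, y) \<in> E)" "E \<subseteq> V \<times> V"
    and pq: "(p, q) \<in> E" "p \<noteq> q"
  shows "connected_on E V"
proof -
  have inv: "refines V c (\<lambda>x y. (x, y) \<in> E\<^sup>* \<inter> V \<times> V)"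
    unfolding refines_def
  proof (intro ballI impI)
    fix x y u v assume V: "x \<in> V" "y \<in> V" "u \<in> V" "v \<in> V" and eq: "c x y = c u v"
    show "((x, y) \<in> E\<^sup>* \<inter> V \<times> V) = ((u, v) \<in> E\<^sup>* \<inter> V \<times> V)"
      using refinesD[OF refines_rtrancl[OF c E] eq V] V by simp
  qed
  have "E\<^sup>* \<inter> V \<times> V = Id_on V \<or> E\<^sup>* \<inter> V \<times> V = V \<times> V"
    by (rule prim[unfolded primitive_def, rule_format, OF equiv_rtrancl[OF E(2) sym_reachability[OF c h E]] inv])
  moreover have "(p, q) \<in> E\<^sup>* \<inter> V \<times> V" using pq(1) E(2) by auto
  then have "E\<^sup>* \<inter> V \<times> V \<noteq> Id_on V" using pq(2) by (metis Id_on_iff)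
  ultimately have full: "E\<^sup>* \<inter> V \<times> V = V \<times> V" by simp
  have "(x, y) \<in> E\<^sup>*" if "x \<in> V" "y \<in> V" for x y
  proof -
    have "(x, y) \<in> E\<^sup>* \<inter> V \<times> V" unfolding full using that by simp
    then show ?thesis by simp
  qed
  moreover have "E \<inter> V \<times> V = E" using E(2) by blast
  ultimately show ?thesis unfolding connected_on_def by simp
qed

text \<open>The arcs with colours in \<open>P \<inter> L\<close> form a digraph \<open>D\<close>
  that is quasi-transitive by \<open>closed\<close> and strongly connected by primitivity, so its
  non-adjacency graph is disconnected. That graph is \<open>N\<close>, made of the colours outside
  \<open>L\<close>; if it had an edge, primitivity would connect it as well.\<close>

lemma primitive_half_system_closed:
  assumes c: "coherent V c" and h: "homogeneous V c" and prim: "primitive V c"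
    and P: "\<forall>x\<in>V. \<forall>y\<in>V. x \<noteq> y \<longrightarrow> (c x y \<in> P \<longleftrightarrow> c y x \<notin> P)"
    and L: "\<And>x y. x \<in> V \<Longrightarrow> y \<in> V \<Longrightarrow> c x y \<in> L \<longleftrightarrow> c y x \<in> L"
    and closed: "\<And>x y z. x \<in> V \<Longrightarrow> y \<in> V \<Longrightarrow> z \<in> V \<Longrightarrow> x \<noteq> y \<Longrightarrow> y \<noteq> z \<Longrightarrow> x \<noteq> z \<Longrightarrow> c x y \<in> P \<inter> L \<Longrightarrow> c y z \<in> P \<inter> L \<Longrightarrow> c x z \<in> L"
    and pq: "p \<in> V" "q \<in> V" "p \<noteq> q" "c p q \<in> L"
    and xy: "x \<in> V" "y \<in> V" "x \<noteq> y"
  shows "c x y \<in> L"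
proof (rule ccontr)
  assume nL: "c x y \<notin> L"
  define D where "D = {(x, y) \<in> V \<times> V. x \<noteq> y \<and> c x y \<in> P \<inter> L}"
  define N where "N = {(x, y) \<in> V \<times> V. x \<noteq> y \<and> c x y \<notin> L}"
  have neq: "refines V c (\<lambda>x y. x \<noteq> y)"
    using refines_comp[OF coherent_refines_eq[OF c], of Not] .
  have "refines V c (\<lambda>x y. x \<noteq> y \<and> c x y \<in> P \<inter> L)"
    using refines_comp2[OF neq refines_refl, of "\<lambda>s t. s \<and> t \<in> P \<inter> L"] .
  then have D: "refines V c (\<lambda>x y. (x, y) \<in> D)" "D \<subseteq> V \<times> V"
    unfolding D_def refines_def by blast+
  have "refines V c (\<lambda>x y. x \<noteq> y \<and> c x y \<notin> L)"
    using refines_comp2[OF neq refines_refl, of "\<lambda>s t. s \<and> t \<notin> L"] .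
  then have N: "refines V c (\<lambda>x y. (x, y) \<in> N)" "N \<subseteq> V \<times> V"
    unfolding N_def refines_def by blast+
  have inD: "(x, y) \<in> D \<or> (y, x) \<in> D" if "x \<in> V" "y \<in> V" "x \<noteq> y" "c x y \<in> L" for x y
    using P[rule_format, OF that(1-3)] L[OF that(1,2)] that unfolding D_def by blast
  have qt: "(x, w) \<in> D \<or> (w, x) \<in> D" if "(x, y) \<in> D" "(y, w) \<in> D" "x \<noteq> w" for x y w
  proof -
    have "x \<in> V" "y \<in> V" "w \<in> V" "x \<noteq> y" "y \<noteq> w" "c x y \<in> P \<inter> L" "c y w \<in> P \<inter> L"
      using that(1,2) by (auto simp: D_def)
    then show ?thesis using closed[of x y w] inD[of x w] that(3) by blast
  qed
  have conD: "connected_on D V"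
    using inD[OF pq] primitive_connected[OF c h prim D, of p q] primitive_connected[OF c h prim D, of q p] pq(3) by blast
  have "card V \<ge> 2"
  proof -
    have "{x, y} \<subseteq> V" "card {x, y} = 2" using xy by auto
    then show ?thesis using card_mono[of V "{x, y}"] coherent_finite[OF c] by simp
  qed
  then have "\<not> connected_on {(x, y). x \<noteq> y \<and> (x, y) \<notin> D \<and> (y, x) \<notin> D} V"
    by (rule quasi_transitive_not_connected[OF coherent_finite[OF c] _ _ conD]) (rule qt)
  moreover have "{(x, y). x \<noteq> y \<and> (x, y) \<notin> D \<and> (y, x) \<notin> D} \<inter> V \<times> V = N \<inter> V \<times> V"
    using inD L unfolding D_def N_def by blast
  moreover have "connected_on N V"
    by (rule primitive_connected[OF c h prim N, of x y]) (use nL xy in \<open>auto simp: N_def\<close>)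
  ultimately show False unfolding connected_on_def by simp
qed

text \<open>The union of all stages satisfies the closure hypothesis of
  \<open>primitive_half_system_closed\<close>. Converses are added along with each colour because
  the level of a colour must equal that of its converse.\<close>

primrec level_set :: "'a set \<Rightarrow> ('a \<Rightarrow> 'a \<Rightarrow> 'c) \<Rightarrow> 'c set \<Rightarrow> 'c set \<Rightarrow> nat \<Rightarrow> 'c set" where
  "level_set V c P A 0 = A"
| "level_set V c P A (Suc k) = level_set V c P A k \<union>
     {s. \<exists>p\<in>V. \<exists>u\<in>V. \<exists>q\<in>V. p \<noteq> u \<and> u \<noteq> q \<and> p \<noteq> q \<and> (s = c p q \<or> s = c q p) \<and>
        c p u \<in> P \<inter> level_set V c P A k \<and> c u q \<in> P \<inter> level_set V c P A k}"

lemma level_set_mono: "k \<le> l \<Longrightarrow> level_set V c P A k \<subseteq> level_set V c P A l"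
  by (rule lift_Suc_mono_le[of "level_set V c P A"]) (unfold level_set.simps, rule Un_upper1)

lemma level_set_Suc_cases:
  assumes "s \<in> level_set V c P A (Suc k)" "s \<notin> level_set V c P A k"
  shows "\<exists>p\<in>V. \<exists>u\<in>V. \<exists>q\<in>V. p \<noteq> u \<and> u \<noteq> q \<and> p \<noteq> q \<and> (s = c p q \<or> s = c q p) \<and>
        c p u \<in> P \<inter> level_set V c P A k \<and> c u q \<in> P \<inter> level_set V c P A k"
  using assms unfolding level_set.simps Un_iff mem_Collect_eq by (elim disjE) (erule (1) notE)

lemma level_set_SucI:
  assumes "p \<in> V" "u \<in> V" "q \<in> V" "p \<noteq> u" "u \<noteq> q" "p \<noteq> q" "s = c p q \<or> s = c q p"
    "c p u \<in> P \<inter> level_set V c P A k" "c u q \<in> P \<inter> level_set V c P A k"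
  shows "s \<in> level_set V c P A (Suc k)"
  unfolding level_set.simps by (intro UnI2 CollectI bexI conjI) (fact assms)+

lemma level_set_converse:
  assumes c: "coherent V c" and A: "\<And>x y. x \<in> V \<Longrightarrow> y \<in> V \<Longrightarrow> c x y \<in> A \<Longrightarrow> c y x \<in> A"
    and V: "x \<in> V" "y \<in> V" and "c x y \<in> level_set V c P A k"
  shows "c y x \<in> level_set V c P A k"
  using assms(5)
proof (induction k)
  case 0
  then show ?case using A V by simp
next
  case (Suc k)
  show ?case
  proof (cases "c x y \<in> level_set V c P A k")
    case True
    then show ?thesis using Suc.IH by simp
  next
    case False
    from level_set_Suc_cases[OF Suc.prems this]
    obtain p u q where pu: "p \<in> V" "u \<in> V" "q \<in> V" "p \<noteq> u" "u \<noteq> q" "p \<noteq> q"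
      and xy: "c x y = c p q \<or> c x y = c q p"
      and k: "c p u \<in> P \<inter> level_set V c P A k" "c u q \<in> P \<inter> level_set V c P A k"
      by (elim bexE conjE)
    have "c y x = c p q \<or> c y x = c q p"
      using xy coherent_converse[OF c _ V pu(1,3)] coherent_converse[OF c _ V pu(3,1)] by (elim disjE) simp_all
    then show ?thesis using k by (rule level_set_SucI[OF pu])
  qed
qed

text \<open>The level of a colour is the first stage of \<open>level_set\<close>, started from
  \<open>c p q\<close> and its converse, that contains it;
  \<open>primitive_half_system_closed\<close> shows that every off-diagonal colour occurs at some
  stage. A colour new at stage \<open>Suc k\<close> arises from two colours present at stage
  \<open>k\<close>, whose levels are therefore smaller.\<close>

lemma ex_level:
  assumes c: "coherent V c" and h: "homogeneous V c" and prim: "primitive V c"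
    and P: "\<forall>x\<in>V. \<forall>y\<in>V. x \<noteq> y \<longrightarrow> (c x y \<in> P \<longleftrightarrow> c y x \<notin> P)"
    and pq: "p \<in> V" "q \<in> V" "p \<noteq> q"
  shows "\<exists>lev :: 'c \<Rightarrow> nat. (\<forall>x\<in>V. \<forall>y\<in>V. x \<noteq> y \<longrightarrow> lev ((c :: 'a \<Rightarrow> 'a \<Rightarrow> 'c) x y) = lev (c y x)) \<and>
     (\<forall>x\<in>V. \<forall>y\<in>V. x \<noteq> y \<longrightarrow> lev (c x y) = 0 \<longrightarrow> c x y = c p q \<or> c x y = c q p) \<and> lev (c p q) = 0 \<and>
     (\<forall>x\<in>V. \<forall>y\<in>V. x \<noteq> y \<longrightarrow> lev (c x y) > 0 \<longrightarrow>
        (\<exists>f s u. (f = x \<and> s = y \<or> f = y \<and> s = x) \<and> u \<in> V \<and> u \<noteq> f \<and> u \<noteq> s \<and> c f u \<in> P \<and> c u s \<in> P \<and>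
          lev (c f u) < lev (c x y) \<and> lev (c u s) < lev (c x y)))"
proof -
  define A where "A = {c p q, c q p}"
  define M where "M k = level_set V c P A k" for k
  have A: "c y x \<in> A" if "x \<in> V" "y \<in> V" "c x y \<in> A" for x y
    using that coherent_converse[OF c _ that(1,2)] pq unfolding A_def by blast
  have conv: "c y x \<in> M k" if "x \<in> V" "y \<in> V" "c x y \<in> M k" for x y k
    using level_set_converse[OF c A that(1,2)] that(3) unfolding M_def by blast
  have mono: "M k \<subseteq> M l" if "k \<le> l" for k l unfolding M_def using that by (rule level_set_mono)
  have all: "c x y \<in> (\<Union>k. M k)" if xy: "x \<in> V" "y \<in> V" "x \<noteq> y" for x y
  proof (rule primitive_half_system_closed[OF c h prim P _ _ pq _ xy])
    show "c x y \<in> (\<Union>k. M k) \<longleftrightarrow> c y x \<in> (\<Union>k. M k)" if "x \<in> V" "y \<in> V" for x y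
      using conv[OF that] conv[OF that(2,1)] by blast
    have "c p q \<in> M 0" by (simp add: M_def A_def)
    then show "c p q \<in> (\<Union>k. M k)" by blast
    fix x y z assume V: "x \<in> V" "y \<in> V" "z \<in> V" "x \<noteq> y" "y \<noteq> z" "x \<noteq> z"
      and "c x y \<in> P \<inter> (\<Union>k. M k)" "c y z \<in> P \<inter> (\<Union>k. M k)"
    then obtain k l where kl: "c x y \<in> P \<inter> M k" "c y z \<in> P \<inter> M l" by blast
    have "c x y \<in> P \<inter> M (max k l)" "c y z \<in> P \<inter> M (max k l)"
      using kl mono[of k "max k l"] mono[of l "max k l"] by auto
    then have "c x z \<in> M (Suc (max k l))"
      unfolding M_def by (rule level_set_SucI[OF V disjI1[OF refl]])
    then show "c x z \<in> (\<Union>k. M k)" by blast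
  qed
  define lev where "lev s = (LEAST k. s \<in> M k)" for s
  have mem: "c x y \<in> M (lev (c x y))" if xy: "x \<in> V" "y \<in> V" "x \<noteq> y" for x y
    using all[OF xy] unfolding lev_def by (auto intro: LeastI)
  have le: "lev s \<le> k" if "s \<in> M k" for s k
    unfolding lev_def using that by (rule Least_le)
  have nmem: "s \<notin> M k" if "k < lev s" for s k using le[of s k] that by auto
  have "lev (c x y) = lev (c y x)" if xy: "x \<in> V" "y \<in> V" "x \<noteq> y" for x y
    using le[OF conv[OF xy(1,2) mem[OF xy]]] le[OF conv[OF xy(2,1) mem[OF xy(2,1) xy(3)[symmetric]]]] by simp
  moreover have "c x y = c p q \<or> c x y = c q p" if xy: "x \<in> V" "y \<in> V" "x \<noteq> y" and "lev (c x y) = 0" for x y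
    using mem[OF xy] that(4) by (simp add: M_def A_def)
  moreover have "lev (c p q) = 0"
    using le[of "c p q" 0] by (simp add: M_def A_def)
  moreover have "\<exists>f s u. (f = x \<and> s = y \<or> f = y \<and> s = x) \<and> u \<in> V \<and> u \<noteq> f \<and> u \<noteq> s \<and> c f u \<in> P \<and> c u s \<in> P \<and>
          lev (c f u) < lev (c x y) \<and> lev (c u s) < lev (c x y)"
    if xy: "x \<in> V" "y \<in> V" "x \<noteq> y" and pos: "lev (c x y) > 0" for x y
  proof -
    obtain k where k: "lev (c x y) = Suc k" using pos by (cases "lev (c x y)") auto
    have "c x y \<in> M (Suc k)" "c x y \<notin> M k" using mem[OF xy] nmem[of k "c x y"] k by auto
    from level_set_Suc_cases[OF this[unfolded M_def], folded M_def]
    obtain p u q where pu: "p \<in> V" "u \<in> V" "q \<in> V" "p \<noteq> u" "u \<noteq> q" "p \<noteq> q" "c x y = c p q \<or> c x y = c q p"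
      and k': "c p u \<in> P \<inter> M k" "c u q \<in> P \<inter> M k"
      by (elim bexE conjE)
    \<comment> \<open>The path from \<open>p\<close> through \<open>u\<close> to \<open>q\<close>
      was found elsewhere in \<open>V\<close>. Once the pair is oriented so that
      \<open>c f s = c p q\<close>, coherence copies the path between \<open>x\<close> and
      \<open>y\<close>.\<close>
    define f where "f = (if c x y = c p q then x else y)"
    define s where "s = (if c x y = c p q then y else x)"
    have fs: "f = x \<and> s = y \<or> f = y \<and> s = x" by (auto simp: f_def s_def)
    have fsV: "f \<in> V" "s \<in> V" using fs xy by auto
    have "c p q = c f s"
    proof (cases "c x y = c p q")
      case False
      then have "c x y = c q p" using pu(7) by blast
      then show ?thesis using False coherent_converse[OF c _ xy(1,2) pu(3,1)] by (simp add: f_def s_def)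
    qed (simp add: f_def s_def)
    have "refines V c (\<lambda>x y. c x y \<in> P \<inter> M k \<and> x \<noteq> y)"
      using refines_comp2[OF refines_refl coherent_refines_eq[OF c], of "\<lambda>t e. t \<in> P \<inter> M k \<and> \<not> e"] .
    from coherent_path[OF c this this \<open>c p q = c f s\<close> pu(1,3) fsV pu(2)] pu(4,5) k'
    have "\<exists>w\<in>V. (c f w \<in> P \<inter> M k \<and> f \<noteq> w) \<and> c w s \<in> P \<inter> M k \<and> w \<noteq> s" by blast
    then obtain w where w: "w \<in> V" "c f w \<in> P \<inter> M k" "f \<noteq> w" "c w s \<in> P \<inter> M k" "w \<noteq> s"
      by (elim bexE conjE)
    have "lev (c f w) \<le> k" "lev (c w s) \<le> k" using le w(2,4) by blast+
    then show ?thesis using fs w k by (intro exI[of _ f] exI[of _ s] exI[of _ w] conjI) auto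
  qed
  ultimately show ?thesis by (intro exI[of _ lev] conjI ballI impI) (assumption | blast)+
qed

section \<open>Individualisation of points and majority counting\<close>

lemma individualise:
  fixes c :: "'a \<Rightarrow> 'a \<Rightarrow> 'c"
  assumes fin: "finite V"
  shows "\<exists>d :: 'a \<Rightarrow> 'a \<Rightarrow> ('a \<times> 'a) set. coherent V d \<and> refines V d c \<and>
     (\<forall>z\<in>R \<inter> V. \<forall>y\<in>V. d z z = d y y \<longrightarrow> y = z) \<and>
     (\<forall>Y :: 'a \<Rightarrow> 'a \<Rightarrow> ('a \<times> 'a) set. coherent V Y \<longrightarrow> refines V Y c \<longrightarrow>
        (\<forall>z\<in>R \<inter> V. \<forall>y\<in>V. Y z z = Y y y \<longrightarrow> y = z) \<longrightarrow> refines V Y d)"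
proof -
  \<comment> \<open>Points of \<open>R\<close> are marked by themselves and all others by
    \<open>None\<close>. The coherent closure of these marked colours is the coarsest fission of
    \<open>c\<close> in which each point of \<open>R\<close> is alone in its fiber.\<close>
  define i where "i p q = (c p q, if p \<in> R then Some p else None, if q \<in> R then Some q else None)" for p q
  let ?d = "closure_colour V i"
  have ri: "refines V ?d i" by (rule refines_closure_colour)
  have "refines V i c" unfolding refines_def i_def by simp
  then have "refines V ?d c" using ri by (rule refines_trans[rotated])
  moreover have "y = z" if "z \<in> R \<inter> V" "y \<in> V" "?d z z = ?d y y" for y z
    using refinesD[OF ri that(3)] that by (auto simp: i_def split: if_splits)
  \<comment> \<open>The \<open>Y\<close>-colour of a pair determines the fibers of its two ends. If
    the points of \<open>R\<close> are alone in their fibers, it also determines both marks, so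
    \<open>Y\<close> refines \<open>i\<close> and hence its closure.\<close>
  moreover have "refines V Y ?d" if Y: "coherent V Y" "refines V Y c" "\<forall>z\<in>R \<inter> V. \<forall>y\<in>V. Y z z = Y y y \<longrightarrow> y = z"
    for Y :: "'a \<Rightarrow> 'a \<Rightarrow> ('a \<times> 'a) set"
  proof (rule closure_colour_coarsest[OF Y(1)])
    show "refines V Y i"
      unfolding refines_def
    proof (intro ballI impI)
      fix x y u v assume V: "x \<in> V" "y \<in> V" "u \<in> V" "v \<in> V" and eq: "Y x y = Y u v"
      have *: "Y x x = Y u u" "Y y y = Y v v"
        using coherent_fst[OF Y(1) eq V] coherent_snd[OF Y(1) eq V] by auto
      have "x = u" if "x \<in> R \<or> u \<in> R" using that Y(3) V *(1) by auto
      moreover have "y = v" if "y \<in> R \<or> v \<in> R" using that Y(3) V *(2) by auto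
      ultimately show "i x y = i u v" using refinesD[OF Y(2) eq V] by (auto simp: i_def)
    qed
  qed
  ultimately show ?thesis using coherent_closure_colour[OF fin, of i] by (intro exI[of _ ?d] conjI) blast+
qed

lemma coherent_in_arc:
  assumes d: "coherent V d" and eq: "d u u = d v v" and V: "u \<in> V" "v \<in> V" "z \<in> V"
  shows "\<exists>w\<in>V. d w v = d z u"
proof -
  have "refines V d (\<lambda>_ _. True)" by (simp add: refines_def)
  from coherent_path[OF d this refines_comp[OF refines_refl, of V d "\<lambda>s. s = d z u"] eq V(1,1,2,2,3)]
  show ?thesis by simp
qed

text \<open>Since \<open>u\<close> and \<open>v\<close> share a fiber, some arc into
  \<open>v\<close> has the colour of the arc from \<open>z\<close> to \<open>u\<close>. It starts in
  the fiber of \<open>z\<close>, that is, at \<open>z\<close>.\<close>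

lemma coherent_singleton_fibre:
  assumes d: "coherent V d" and z: "\<And>y. y \<in> V \<Longrightarrow> d z z = d y y \<Longrightarrow> y = z"
    and V: "z \<in> V" "u \<in> V" "v \<in> V" and eq: "d u u = d v v"
  shows "d z u = d z v"
proof -
  obtain w where w: "w \<in> V" "d w v = d z u" using coherent_in_arc[OF d eq V(2,3,1)] by blast
  then have "d z z = d w w" using coherent_fst[OF d w(2)[symmetric]] V by blast
  then show ?thesis using z w by metis
qed

lemma majority_fibres:
  assumes fin: "finite U" and ne: "U \<noteq> {}"
    and maj: "\<And>v. v \<in> U \<Longrightarrow> card {w\<in>U. f w = f v} < 2 * card {w\<in>U. f w = f v \<and> w \<in> D}"
  shows "card U < 2 * card {w\<in>U. w \<in> D}"
proof -
  have sum: "card {w\<in>U. w \<in> E} = (\<Sum>t\<in>f ` U. card {w\<in>U. f w = t \<and> w \<in> E})" for E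
  proof -
    have "{w\<in>U. w \<in> E} = (\<Union>t\<in>f ` U. {w\<in>U. f w = t \<and> w \<in> E})" by blast
    then show ?thesis using fin by (simp only:) (rule card_UN_disjoint, auto)
  qed
  have "card U = (\<Sum>t\<in>f ` U. card {w\<in>U. f w = t})" using sum[of UNIV] by simp
  also have "\<dots> < (\<Sum>t\<in>f ` U. 2 * card {w\<in>U. f w = t \<and> w \<in> D})"
    using maj by (intro sum_strict_mono) (use fin ne in auto)
  also have "\<dots> = 2 * card {w\<in>U. w \<in> D}" unfolding sum[of D] by (simp add: sum_distrib_left)
  finally show ?thesis .
qed

text \<open>If \<open>s \<rightarrow> x\<close> and \<open>x \<rightarrow> f\<close> have the same \<open>Y\<close>-colour, then the midpoints of the \<open>a, b\<close>-paths from \<open>s\<close>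
  to \<open>x\<close> and from \<open>x\<close> to \<open>f\<close> lie in \<open>D\<close> equally often.\<close>
lemma majority_conflict:
  assumes c: "coherent V c" and Y: "coherent V Y" "refines V Y c" and D: "fibre_union V Y D"
    and V: "x \<in> V" "f \<in> V" "s \<in> V" and eq: "Y s x = Y x f"
    and maj: "card {v\<in>V. c x v = a \<and> c v f = b} < 2 * card {v\<in>V. (c x v = a \<and> v \<in> D) \<and> c v f = b}"
    and min: "card {v\<in>V. c s v = a \<and> c v x = b} < 2 * card {v\<in>V. (c s v = a \<and> v \<notin> D) \<and> c v x = b}"
  shows False
proof -
  have Pa: "refines V Y (\<lambda>p q. c p q = t)" for t
    using refines_comp[OF Y(2), of "\<lambda>s. s = t"] .
  have PD: "refines V Y (\<lambda>p q. c p q = a \<and> q \<in> D)"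
    using refines_comp2[OF Y(2) refines_fibre_union_snd[OF Y(1) D], of "\<lambda>s e. s = a \<and> e"] .
  have 1: "card {v\<in>V. c s v = a \<and> c v x = b} = card {v\<in>V. c x v = a \<and> c v f = b}"
    by (rule refinesD[OF coherent_card[OF Y(1) Pa Pa] eq V(3,1,1,2)])
  have 2: "card {v\<in>V. (c s v = a \<and> v \<in> D) \<and> c v x = b} = card {v\<in>V. (c x v = a \<and> v \<in> D) \<and> c v f = b}"
    by (rule refinesD[OF coherent_card[OF Y(1) PD Pa] eq V(3,1,1,2)])
  have fin: "finite V" using c by (rule coherent_finite)
  have "{v\<in>V. c s v = a \<and> c v x = b} =
      {v\<in>V. (c s v = a \<and> v \<in> D) \<and> c v x = b} \<union> {v\<in>V. (c s v = a \<and> v \<notin> D) \<and> c v x = b}" by blast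
  then have "card {v\<in>V. c s v = a \<and> c v x = b} =
      card {v\<in>V. (c s v = a \<and> v \<in> D) \<and> c v x = b} + card {v\<in>V. (c s v = a \<and> v \<notin> D) \<and> c v x = b}"
    using fin by (simp only:) (rule card_Un_disjoint, auto)
  then show False using maj min 1 2 by linarith
qed

text \<open>As \<open>p\<close> and \<open>q\<close> are alone in their \<open>d\<close>-fibers,
  every \<open>d\<close>-fiber lies entirely inside or entirely outside the set of midpoints of
  \<open>a, b\<close>-paths. The majorities in the single fibers therefore add up to a majority of
  all midpoints.\<close>

lemma majority_path:
  assumes d: "coherent V d" "refines V d c"
    and p: "p \<in> V" "\<And>y. y \<in> V \<Longrightarrow> d p p = d y y \<Longrightarrow> y = p"
    and q: "q \<in> V" "\<And>y. y \<in> V \<Longrightarrow> d q q = d y y \<Longrightarrow> y = q"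
    and u: "u \<in> V" "c p u = a" "c u q = b"
    and maj: "\<And>v. v \<in> V \<Longrightarrow> c p v = a \<Longrightarrow> c v q = b \<Longrightarrow>
       \<exists>G\<subseteq>{w\<in>V. d w w = d v v}. card {w\<in>V. d w w = d v v} < 2 * card G \<and>
          (\<forall>w\<in>G. c p w = a \<longrightarrow> c w q = b \<longrightarrow> w \<in> D)"
  shows "card {v\<in>V. c p v = a \<and> c v q = b} < 2 * card {v\<in>V. (c p v = a \<and> v \<in> D) \<and> c v q = b}"
proof -
  let ?U = "{v\<in>V. c p v = a \<and> c v q = b}"
  have fin: "finite V" using d(1) by (rule coherent_finite)
  have "card ?U < 2 * card {w\<in>?U. w \<in> D}"
  proof (rule majority_fibres[where f = "\<lambda>v. d v v"])
    show "finite ?U" using fin by simp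
    show "?U \<noteq> {}" using u by blast
    fix v assume v: "v \<in> ?U"
    have F: "c p w = a \<and> c w q = b" if w: "w \<in> V" "d w w = d v v" for w
    proof -
      have vV: "v \<in> V" using v by simp
      have "d p w = d p v" using coherent_singleton_fibre[OF d(1) p(2,1) w(1) vV w(2)] .
      then have "c p w = c p v" using refinesD[OF d(2)] p(1) w(1) vV by blast
      moreover have "d q w = d q v" using coherent_singleton_fibre[OF d(1) q(2,1) w(1) vV w(2)] .
      then have "d w q = d v q" using coherent_converse[OF d(1)] q(1) w(1) vV by blast
      then have "c w q = c v q" using refinesD[OF d(2)] q(1) w(1) vV by blast
      ultimately show ?thesis using v by simp
    qed
    have eq: "{w\<in>?U. d w w = d v v} = {w\<in>V. d w w = d v v}" using F by blast
    obtain G where G: "G \<subseteq> {w\<in>V. d w w = d v v}" "card {w\<in>V. d w w = d v v} < 2 * card G"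
      "\<forall>w\<in>G. c p w = a \<longrightarrow> c w q = b \<longrightarrow> w \<in> D"
      using maj[of v] v by blast
    have "G \<subseteq> {w\<in>?U. d w w = d v v \<and> w \<in> D}" using G(1,3) F by blast
    then have "card G \<le> card {w\<in>?U. d w w = d v v \<and> w \<in> D}" using fin by (intro card_mono) auto
    then show "card {w\<in>?U. d w w = d v v} < 2 * card {w\<in>?U. d w w = d v v \<and> w \<in> D}"
      unfolding eq using G(2) by linarith
  qed
  moreover have "{w\<in>?U. w \<in> D} = {v\<in>V. (c p v = a \<and> v \<in> D) \<and> c v q = b}" by blast
  ultimately show ?thesis by simp
qed

text \<open>By homogeneity every colour occurs at \<open>x\<close>, so a minimum over the
  off-diagonal colours at \<open>x\<close> is a minimum over all of them.\<close>

lemma minimal_degree_colour: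
  assumes c: "coherent V c" and h: "homogeneous V c" and x: "x \<in> V" and ne: "V \<noteq> {x}"
  shows "\<exists>q\<in>V. q \<noteq> x \<and> (\<forall>u\<in>V. \<forall>v\<in>V. u \<noteq> v \<longrightarrow> card {z\<in>V. c x z = c x q} \<le> card {z\<in>V. c x z = c u v})"
proof -
  have fin: "finite V" using c by (rule coherent_finite)
  have "finite (V - {x})" "V - {x} \<noteq> {}" using fin x ne by auto
  from ex_is_arg_min_if_finite[OF this, of "\<lambda>y. card {z\<in>V. c x z = c x y}"]
  obtain q where q: "q \<in> V" "q \<noteq> x"
    and min: "\<And>y. y \<in> V \<Longrightarrow> y \<noteq> x \<Longrightarrow> card {z\<in>V. c x z = c x q} \<le> card {z\<in>V. c x z = c x y}"
    by (auto simp: is_arg_min_linorder)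
  have "card {z\<in>V. c x z = c x q} \<le> card {z\<in>V. c x z = c u v}" if V: "u \<in> V" "v \<in> V" "u \<noteq> v" for u v
  proof -
    have "card {z\<in>V. c x z = c u v} = card {z\<in>V. c u z = c u v}"
      by (rule homogeneous_degree[OF c h refines_comp[OF refines_refl, of V c "\<lambda>s. s = c u v"] x V(1)])
    moreover have "card {z\<in>V. c u z = c u v} \<noteq> 0" using V fin by auto
    ultimately have "{z\<in>V. c x z = c u v} \<noteq> {}" by (metis card.empty)
    then obtain y where y: "y \<in> V" "c x y = c u v" by blast
    have "y \<noteq> x" using coherent_diag[OF c, of x u v] y V x by auto
    then show ?thesis using min[OF y(1)] y(2) by simp
  qed
  then show ?thesis using q by blast
qed

lemma fibre_union_fibre: "fibre_union V d {w\<in>V. d w w = t}"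
  unfolding fibre_union_def by auto

lemma ex_good_primitive:
  fixes c :: "'a \<Rightarrow> 'a \<Rightarrow> 'c"
  assumes c: "coherent V c" and a: "antisymmetric V c" and h: "homogeneous V c" and prim: "primitive V c"
    and x: "x \<in> V" and ne: "V \<noteq> {x}"
    and IH: "\<And>W (d :: 'a \<Rightarrow> 'a \<Rightarrow> ('a \<times> 'a) set). W \<subset> V \<Longrightarrow> coherent W d \<Longrightarrow> antisymmetric W d \<Longrightarrow> \<exists>D. good W d D"
  shows "\<exists>D. good V c D"
proof -
  have fin: "finite V" using c by (rule coherent_finite)
  obtain q where q: "q \<in> V" "q \<noteq> x"
    and min: "\<forall>u\<in>V. \<forall>v\<in>V. u \<noteq> v \<longrightarrow> card {z\<in>V. c x z = c x q} \<le> card {z\<in>V. c x z = c u v}"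
    using minimal_degree_colour[OF c h x ne] by (elim bexE conjE)
  define r where "r = c x q"
  \<comment> \<open>The half system is chosen to miss \<open>r\<close>. Pieces with colour in
    \<open>P\<close> must have a majority in \<open>D\<close>; the others only need a minority, so
    the piece of \<open>r\<close> can be left out of \<open>D\<close> altogether.\<close>
  obtain P where rP': "c q x \<in> P"
    and P: "\<forall>x\<in>V. \<forall>y\<in>V. x \<noteq> y \<longrightarrow> (c x y \<in> P \<longleftrightarrow> c y x \<notin> P)"
    using ex_half_system[OF c a q(1) x q(2)] by (elim exE conjE)
  have rP: "r \<notin> P" using P[rule_format, OF q(1) x q(2)] rP' by (simp add: r_def)
  obtain lev :: "'c \<Rightarrow> nat" where lconv: "\<forall>x\<in>V. \<forall>y\<in>V. x \<noteq> y \<longrightarrow> lev (c x y) = lev (c y x)"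
    and l0: "\<forall>u\<in>V. \<forall>v\<in>V. u \<noteq> v \<longrightarrow> lev (c u v) = 0 \<longrightarrow> c u v = c x q \<or> c u v = c q x"
    and lr: "lev (c x q) = 0"
    and lS: "\<forall>x\<in>V. \<forall>y\<in>V. x \<noteq> y \<longrightarrow> lev (c x y) > 0 \<longrightarrow>
        (\<exists>f s u. (f = x \<and> s = y \<or> f = y \<and> s = x) \<and> u \<in> V \<and> u \<noteq> f \<and> u \<noteq> s \<and> c f u \<in> P \<and> c u s \<in> P \<and>
          lev (c f u) < lev (c x y) \<and> lev (c u s) < lev (c x y))"
    using ex_level[OF c h prim P x q(1) q(2)[symmetric]] by (elim exE conjE)
  \<comment> \<open>\<open>d l\<close> fixes \<open>x\<close> and all pieces of level above \<open>l\<close>; \<open>C l v\<close> is the \<open>d l\<close>-fiber of \<open>v\<close>.\<close>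
  define R where "R l = insert x {u\<in>V. u \<noteq> x \<and> lev (c x u) > l}" for l
  have RV: "R l \<inter> V = R l" for l using x by (auto simp: R_def)
  define good_fission where "good_fission l d \<longleftrightarrow> coherent V d \<and> refines V d c \<and>
     (\<forall>z\<in>R l. \<forall>y\<in>V. d z z = d y y \<longrightarrow> y = z) \<and>
     (\<forall>Y :: 'a \<Rightarrow> 'a \<Rightarrow> ('a \<times> 'a) set. coherent V Y \<longrightarrow> refines V Y c \<longrightarrow>
        (\<forall>z\<in>R l. \<forall>y\<in>V. Y z z = Y y y \<longrightarrow> y = z) \<longrightarrow> refines V Y d)"
    for l and d :: "'a \<Rightarrow> 'a \<Rightarrow> ('a \<times> 'a) set"
  define d where "d l = (SOME d. good_fission l d)" for l
  have "\<exists>d. good_fission l d" for l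
    unfolding good_fission_def by (rule individualise[OF fin, of c "R l", unfolded RV])
  then have "good_fission l (d l)" for l
    unfolding d_def by (rule someI_ex)
  then have dc: "\<And>l. coherent V (d l)" and dref: "\<And>l. refines V (d l) c"
    and dsing: "\<And>l z y. z \<in> R l \<Longrightarrow> y \<in> V \<Longrightarrow> d l z z = d l y y \<Longrightarrow> y = z"
    and dmin: "\<And>l Y. coherent V Y \<Longrightarrow> refines V Y c \<Longrightarrow>
      (\<And>z y. z \<in> R l \<Longrightarrow> y \<in> V \<Longrightarrow> (Y :: 'a \<Rightarrow> 'a \<Rightarrow> ('a \<times> 'a) set) z z = Y y y \<Longrightarrow> y = z) \<Longrightarrow> refines V Y (d l)"
    unfolding good_fission_def by (blast, blast, blast, simp)
  have xR: "x \<in> R l" for l by (simp add: R_def)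
  define C where "C l v = {w\<in>V. d l w w = d l v v}" for l v
  define g where "g l W = (SOME G. good W (d l) G \<and> card W < 2 * card G)" for l W
  have colC: "c x w = c x v" if w: "w \<in> C l v" and v: "v \<in> V" for w v l
  proof -
    have wV: "w \<in> V" "d l w w = d l v v" using w by (auto simp: C_def)
    have "d l x w = d l x v" by (rule coherent_singleton_fibre[OF dc dsing[OF xR] x wV(1) v wV(2)])
    then show ?thesis using refinesD[OF dref] x wV(1) v by blast
  qed
  have gC: "good (C l v) (d l) (g l (C l v)) \<and> card (C l v) < 2 * card (g l (C l v))"
    if v: "v \<in> V" "v \<noteq> x" for l v
  proof -
    have sub: "C l v \<subseteq> V" by (auto simp: C_def)
    have "x \<notin> C l v" using dsing[OF xR v(1), of l] v(2) by (auto simp: C_def)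
    then have "C l v \<subset> V" using sub x by blast
    moreover have coh: "coherent (C l v) (d l)"
      by (rule coherent_restrict_fibres[OF dc sub]) (simp add: C_def fibre_union_fibre)
    moreover have anti: "antisymmetric (C l v) (d l)"
      by (rule antisymmetric_subset[OF antisymmetric_refines[OF a dref] sub])
    ultimately obtain G where G: "good (C l v) (d l) G" using IH by blast
    have "v \<in> C l v" using v by (simp add: C_def)
    moreover have "homogeneous (C l v) (d l)" by (simp add: homogeneous_def C_def)
    ultimately have "odd (card (C l v))" using odd_card_homogeneous[OF coh anti] by blast
    from good_majority[OF G this coherent_finite[OF coh]]
    show ?thesis unfolding g_def by (rule someI_ex)
  qed
  \<comment> \<open>The rule uses the fission \<open>d l\<close> with \<open>l\<close> the level of
    the piece of \<open>w\<close>. By \<open>colC\<close> each fiber \<open>C l v\<close> lies in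
    one piece, so such a fiber, away from the piece of \<open>r\<close>, meets \<open>D\<close> in
    its majority set or in the complement of that set, according to whether the colour is in
    \<open>P\<close>.\<close>
  define D where "D = {w\<in>V. w = x \<or> c x w \<noteq> r \<and>
    (w \<in> g (lev (c x w)) (C (lev (c x w)) w) \<longleftrightarrow> c x w \<in> P)}"
  have "good V c D"
    unfolding good_def
  proof (intro conjI allI impI)
    show "D \<subseteq> V" by (auto simp: D_def)
  next
    fix Y :: "'a \<Rightarrow> 'a \<Rightarrow> ('a \<times> 'a) set"
    assume Y: "coherent V Y" "refines V Y c" and YD: "fibre_union V Y D"
    have Ceq: "C l w = C l v" if "w \<in> C l v" for l w v using that by (auto simp: C_def)
    \<comment> \<open>Midpoints from \<open>x\<close> to \<open>f\<close> lie in the piece of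
      \<open>c x u\<close>, with colour in \<open>P\<close>; midpoints from \<open>s\<close> to
      \<open>x\<close> lie in the piece of the converse of \<open>c u f\<close>, with colour outside
      \<open>P\<close>. In each case the piece has smaller level than the ends \<open>f\<close> and
      \<open>s\<close>, so the fission \<open>d\<close> at its level fixes both ends of the paths,
      as \<open>majority_path\<close> requires.\<close>
    have core: False
      if fs: "f \<in> V" "s \<in> V" "f \<noteq> x" "Y s x = Y x f" and u: "u \<in> V" "u \<noteq> x" "u \<noteq> f" "c x u \<in> P" "c u f \<in> P"
        and lt: "lev (c x u) < lev (c x f)" "lev (c u f) < lev (c x f)" for f s u
    proof (rule majority_conflict[OF c Y YD x fs(1,2,4), of "c x u" "c u f"])
      have csx: "c s x = c x f" using refinesD[OF Y(2) fs(4)] fs x by blast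
      have sx: "s \<noteq> x" using coherent_diag[OF c, of x x f] csx fs x by auto
      have lcs: "lev (c x s) = lev (c x f)" using lconv[rule_format, OF fs(2) x sx] csx by simp
      show "card {v\<in>V. c x v = c x u \<and> c v f = c u f} < 2 * card {v\<in>V. (c x v = c x u \<and> v \<in> D) \<and> c v f = c u f}"
      proof (rule majority_path[OF dc[of "lev (c x u)"] dref x _ fs(1) _ u(1) refl refl])
        let ?l = "lev (c x u)"
        show "y = x" if "y \<in> V" "d ?l x x = d ?l y y" for y using dsing[OF xR that] .
        have "f \<in> R ?l" using fs lt by (simp add: R_def)
        then show "y = f" if "y \<in> V" "d ?l f f = d ?l y y" for y using dsing that by blast
        fix v assume v: "v \<in> V" "c x v = c x u"
        have vx: "v \<noteq> x" using coherent_diag[OF c, of x x u] v u x by auto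
        have gg: "g ?l (C ?l v) \<subseteq> C ?l v" "card (C ?l v) < 2 * card (g ?l (C ?l v))"
          using gC[OF v(1) vx, of ?l] by (auto simp: good_def)
        have "w \<in> D" if w: "w \<in> g ?l (C ?l v)" for w
        proof -
          have wC: "w \<in> C ?l v" using w gg(1) by blast
          have cw: "c x w = c x u" using colC[OF wC v(1)] v(2) by simp
          have "w \<in> V" using wC by (simp add: C_def)
          then show ?thesis using w u(4) rP by (auto simp: D_def cw Ceq[OF wC])
        qed
        then show "\<exists>G\<subseteq>{w\<in>V. d ?l w w = d ?l v v}. card {w\<in>V. d ?l w w = d ?l v v} < 2 * card G \<and>
          (\<forall>w\<in>G. c x w = c x u \<longrightarrow> c w f = c u f \<longrightarrow> w \<in> D)"
          using gg unfolding C_def by blast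
      qed
      have "card {v\<in>V. c s v = c x u \<and> c v x = c u f} < 2 * card {v\<in>V. (c s v = c x u \<and> v \<in> - D) \<and> c v x = c u f}"
      proof -
        let ?l = "lev (c u f)"
        have "\<exists>w\<in>V. c s w = c x u \<and> c w x = c u f"
          using coherent_path[OF c refines_comp[OF refines_refl, of V c "\<lambda>t. t = c x u"]
              refines_comp[OF refines_refl, of V c "\<lambda>t. t = c u f"] csx[symmetric] x fs(1,2) x u(1)] by simp
        then obtain w where w: "w \<in> V" "c s w = c x u" "c w x = c u f" by blast
        show ?thesis
        proof (rule majority_path[OF dc[of ?l] dref fs(2) _ x _ w])
          show "y = x" if "y \<in> V" "d ?l x x = d ?l y y" for y using dsing[OF xR that] .
          have "s \<in> R ?l" using fs sx lt lcs by (simp add: R_def)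
          then show "y = s" if "y \<in> V" "d ?l s s = d ?l y y" for y using dsing that by blast
          fix v assume v: "v \<in> V" "c v x = c u f"
          have vx: "v \<noteq> x" using coherent_diag[OF c, of x u f] v u x fs by auto
          have gg: "g ?l (C ?l v) \<subseteq> C ?l v" "card (C ?l v) < 2 * card (g ?l (C ?l v))"
            using gC[OF v(1) vx, of ?l] by (auto simp: good_def)
          have lv: "lev (c x v) = ?l" using lconv[rule_format, OF v(1) x vx] v(2) by simp
          have nP: "c x v \<notin> P" using P[rule_format, OF v(1) x vx] v(2) u(5) by simp
          have "w \<in> - D" if w: "w \<in> g ?l (C ?l v)" for w
          proof -
            have wC: "w \<in> C ?l v" using w gg(1) by blast
            have cw: "c x w = c x v" using colC[OF wC v(1)] .
            have "w \<noteq> x" using coherent_diag[OF c, of x x v] cw v vx x by auto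
            then show ?thesis using w nP by (auto simp: D_def cw lv Ceq[OF wC])
          qed
          then show "\<exists>G\<subseteq>{w\<in>V. d ?l w w = d ?l v v}. card {w\<in>V. d ?l w w = d ?l v v} < 2 * card G \<and>
            (\<forall>w\<in>G. c s w = c x u \<longrightarrow> c w x = c u f \<longrightarrow> w \<in> - D)"
            using gg unfolding C_def by blast
        qed
      qed
      then show "card {v\<in>V. c s v = c x u \<and> c v x = c u f} < 2 * card {v\<in>V. (c s v = c x u \<and> v \<notin> D) \<and> c v x = c u f}"
        by simp
    qed
    have Yx: "y = x" if y: "y \<in> V" "Y x x = Y y y" for y
    proof (rule ccontr)
      assume yx: "y \<noteq> x"
      \<comment> \<open>As \<open>y\<close> shares the fiber of \<open>x\<close>, an arc of colour
        \<open>Y x y\<close> also enters \<open>x\<close>; its tail \<open>z\<close> supplies the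
        point \<open>s\<close> of \<open>core\<close>.\<close>
      obtain z where z: "z \<in> V" "Y z x = Y x y"
        using coherent_in_arc[OF Y(1) y(2)[symmetric] y(1) x x] by blast
      have xD: "x \<in> D" using x by (simp add: D_def)
      have yD: "y \<in> D" using YD y x xD unfolding fibre_union_def by blast
      have "Y z z = Y x x" by (rule coherent_fst[OF Y(1) z(2) z(1) x x y(1)])
      then have zD: "z \<in> D" using YD z x xD unfolding fibre_union_def by blast
      have czx: "c z x = c x y" using refinesD[OF Y(2) z(2)] z x y by blast
      have zx: "z \<noteq> x" using coherent_diag[OF c, of x x y] czx y x yx by auto
      have cxz: "c x z = c y x" by (rule coherent_converse[OF c czx z(1) x x y(1)])
      \<comment> \<open>Both \<open>y\<close> and \<open>z\<close> share the fiber of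
        \<open>x\<close>, hence lie in \<open>D\<close>, while \<open>D\<close> misses the piece of
        \<open>r\<close>. As \<open>c x z\<close> is the converse of \<open>c x y\<close>, neither
        \<open>r\<close> nor its converse equals \<open>c x y\<close>, and only these two colours
        have level zero.\<close>
      have "c x y \<noteq> r" "c x z \<noteq> r" using yD zD yx zx by (auto simp: D_def)
      moreover have "c y x = r" if "c x y = c q x"
        using coherent_converse[OF c that x y(1) q(1) x] by (simp add: r_def)
      ultimately have pos: "lev (c x y) > 0"
        using l0[rule_format, OF x y(1)] yx cxz r_def by (cases "lev (c x y) = 0") auto
      obtain f s u where fs: "f = x \<and> s = y \<or> f = y \<and> s = x" and u: "u \<in> V" "u \<noteq> f" "u \<noteq> s" "c f u \<in> P" "c u s \<in> P"
          "lev (c f u) < lev (c x y)" "lev (c u s) < lev (c x y)"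
        using lS[rule_format, OF x y(1) yx[symmetric] pos] by (elim exE conjE)
      from fs show False
      proof (elim disjE conjE)
        assume "f = x" "s = y"
        then show False using core[OF y(1) z(1) yx z(2)] u by blast
      next
        assume fs: "f = y" "s = x"
        \<comment> \<open>The product now contains the converse colour \<open>c y x = c x z\<close>.
          Thus \<open>z\<close> and \<open>y\<close> exchange roles, and the path from
          \<open>y\<close> through \<open>u\<close> to \<open>x\<close> is copied from
          \<open>x\<close> to \<open>z\<close>.\<close>
        have e: "Y y x = Y x z" using coherent_converse[OF Y(1) z(2) z(1) x x y(1)] by simp
        have neq: "refines V c (\<lambda>x y. c x y = t \<and> x \<noteq> y)" for t
          using refines_comp2[OF refines_refl coherent_refines_eq[OF c], of "\<lambda>s e. s = t \<and> \<not> e"] .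
        have "\<exists>w\<in>V. (c x w = c f u \<and> x \<noteq> w) \<and> (c w z = c u s \<and> w \<noteq> z)"
          by (rule coherent_path[OF c neq neq, of y x x z u]) (use cxz y x z u fs in auto)
        then obtain w where w: "w \<in> V" "c x w = c f u" "x \<noteq> w" "c w z = c u s" "w \<noteq> z" by blast
        have "lev (c x z) = lev (c x y)" using lconv[rule_format, OF z(1) x zx] czx by simp
        then show False using core[OF z(1) y(1) zx e w(1)] w u by simp
      qed
    qed
    define K where "K = Max (insert 0 ((\<lambda>u. lev (c x u)) ` V))"
    have K: "lev (c x u) \<le> K" if "u \<in> V" for u
      unfolding K_def using that fin by (intro Max_ge) auto
    \<comment> \<open>Descending induction on the level of a piece, measured by its distance from
      the bound \<open>K\<close>. Once all pieces of higher level consist of fixed points,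
      minimality of \<open>d\<close> makes \<open>Y\<close> refine \<open>d\<close> at the current
      level, and the good sets chosen in its fibers become effective.\<close>
    have resolved: "\<forall>u\<in>V. u \<noteq> x \<longrightarrow> c x u \<noteq> r \<longrightarrow> K - lev (c x u) = n \<longrightarrow> (\<forall>w\<in>V. Y u u = Y w w \<longrightarrow> w = u)" for n
    proof (induction n rule: less_induct)
      case (less n)
      show ?case
      proof (intro ballI impI)
        fix u w assume u: "u \<in> V" "u \<noteq> x" "c x u \<noteq> r" "K - lev (c x u) = n" and w: "w \<in> V" "Y u u = Y w w"
        let ?l = "lev (c x u)"
        have ref: "refines V Y (d ?l)"
        proof (rule dmin[OF Y])
          fix z y assume z: "z \<in> R ?l" and y: "y \<in> V" "Y z z = Y y y"
          show "y = z"
          proof (cases "z = x")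
            case True
            then show ?thesis using Yx y by blast
          next
            case False
            then have zV: "z \<in> V" "lev (c x z) > ?l" using z by (auto simp: R_def)
            then have "c x z \<noteq> r" using lr by (auto simp: r_def)
            moreover have "K - lev (c x z) < n" using zV(2) K[OF zV(1)] u(4) by linarith
            ultimately show ?thesis using less.IH[rule_format, OF _ zV(1) False _ refl] y by blast
          qed
        qed
        let ?C = "C ?l u"
        have sub: "?C \<subseteq> V" by (auto simp: C_def)
        have un: "fibre_union V Y ?C"
          unfolding fibre_union_def
        proof (intro ballI impI)
          fix p q assume "p \<in> V" "q \<in> V" "Y p p = Y q q"
          then show "(p \<in> ?C) = (q \<in> ?C)" using refinesD[OF ref, of p p q q] by (auto simp: C_def)
        qed
        have "fibre_union ?C Y (g ?l ?C)"
          unfolding fibre_union_def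
        proof (intro ballI impI)
          have D: "p \<in> D \<longleftrightarrow> (p \<in> g ?l ?C \<longleftrightarrow> c x u \<in> P)" if p: "p \<in> ?C" for p
          proof -
            have cp: "c x p = c x u" using colC[OF p u(1)] .
            have "p \<noteq> x" using coherent_diag[OF c, of x x u] cp u x by auto
            moreover have "p \<in> V" using p sub by blast
            ultimately show ?thesis using u(3) by (simp add: D_def cp Ceq[OF p])
          qed
          fix p q assume pq: "p \<in> ?C" "q \<in> ?C" "Y p p = Y q q"
          then have "p \<in> D \<longleftrightarrow> q \<in> D" using YD sub unfolding fibre_union_def by blast
          then show "(p \<in> g ?l ?C) = (q \<in> g ?l ?C)" using D[OF pq(1)] D[OF pq(2)] by blast
        qed
        then have inj: "inj_on (\<lambda>x. Y x x) ?C"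
          using good_inj_on[OF _ coherent_restrict_fibres[OF Y(1) sub un] refines_subset[OF ref sub]] gC[OF u(1,2)] by blast
        have "d ?l u u = d ?l w w" using refinesD[OF ref w(2)] u(1) w(1) by blast
        then have "w \<in> ?C" "u \<in> ?C" using u(1) w(1) by (auto simp: C_def)
        then show "w = u" using inj w(2) by (auto simp: inj_on_def)
      qed
    qed
    have sing: "w = z" if "z \<in> V" "z = x \<or> c x z \<noteq> r" "w \<in> V" "Y z z = Y w w" for z w
      using resolved[rule_format, OF that(1) _ _ refl that(3,4)] Yx that by (cases "z = x") auto
    show "inj_on (\<lambda>x. Y x x) V"
    proof (rule inj_onI, rule ccontr)
      fix u w assume u: "u \<in> V" "w \<in> V" "Y u u = Y w w" and uw: "u \<noteq> w"
      \<comment> \<open>Only the piece of \<open>r\<close> remains. A point outside it that sees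
        \<open>u\<close> and \<open>w\<close> in different colours is alone in its
        \<open>Y\<close>-fiber, and so puts \<open>u\<close> and \<open>w\<close> in different
        fibers.\<close>
      obtain z where z: "z \<in> V" "c x z \<noteq> r" "c z u \<noteq> c z w"
        using minimal_degree_separated[OF c a h x u(1,2) uw min[rule_format, OF u(1,2) uw]] by (auto simp: r_def)
      have "Y z u = Y z w"
        by (rule coherent_singleton_fibre[OF Y(1) _ z(1) u]) (use sing z in blast)
      then show False using refinesD[OF Y(2)] z u by blast
    qed
  qed
  then show ?thesis by blast
qed

section \<open>Inhomogeneous and imprimitive configurations\<close>

text \<open>The fibers \<open>W t\<close> of \<open>c\<close> stay unions of fibers in every
  fission, so each of them is resolved separately by its own good set \<open>G t\<close>.\<close>

lemma ex_good_inhomogeneous: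
  assumes c: "coherent V c" and a: "antisymmetric V c" and h: "\<not> homogeneous V c"
    and IH: "\<And>W. W \<subset> V \<Longrightarrow> coherent W c \<Longrightarrow> antisymmetric W c \<Longrightarrow> \<exists>D. good W c D"
  shows "\<exists>D. good V c D"
proof -
  define W where "W t = {w\<in>V. c w w = t}" for t
  define G where "G t = (SOME D. good (W t) c D)" for t
  have sub: "W t \<subseteq> V" for t by (auto simp: W_def)
  have G: "good (W t) c (G t)" for t
  proof -
    have "W t \<subset> V"
    proof (rule psubsetI[OF sub])
      show "W t \<noteq> V"
      proof
        assume eq: "W t = V"
        have "c u u = t" if "u \<in> V" for u
        proof -
          have "u \<in> W t" using that eq by simp
          then show ?thesis by (simp add: W_def)
        qed
        then have "homogeneous V c" by (simp add: homogeneous_def)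
        then show False using h by contradiction
      qed
    qed
    moreover have "coherent (W t) c"
      by (rule coherent_restrict_fibres[OF c sub]) (simp add: W_def fibre_union_fibre)
    moreover have "antisymmetric (W t) c" by (rule antisymmetric_subset[OF a sub])
    ultimately have "\<exists>D. good (W t) c D" by (rule IH)
    then show ?thesis unfolding G_def by (rule someI_ex)
  qed
  define D where "D = {x\<in>V. x \<in> G (c x x)}"
  have "good V c D"
    unfolding good_def
  proof (intro conjI allI impI)
    show "D \<subseteq> V" by (auto simp: D_def)
  next
    fix Y :: "'a \<Rightarrow> 'a \<Rightarrow> ('a \<times> 'a) set"
    assume Y: "coherent V Y" "refines V Y c" and YD: "fibre_union V Y D"
    have col: "c u u = c w w" if "u \<in> V" "w \<in> V" "Y u u = Y w w" for u w
      using refinesD[OF Y(2) that(3)] that by blast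
    have inj: "inj_on (\<lambda>x. Y x x) (W t)" for t
    proof (rule good_inj_on[OF G _ refines_subset[OF Y(2) sub]])
      have "fibre_union V Y (W t)"
        unfolding fibre_union_def
      proof (intro ballI impI)
        fix u w assume "u \<in> V" "w \<in> V" "Y u u = Y w w"
        then show "(u \<in> W t) = (w \<in> W t)" using col[of u w] by (simp add: W_def)
      qed
      then show "coherent (W t) Y" by (rule coherent_restrict_fibres[OF Y(1) sub])
      have "p \<in> D \<longleftrightarrow> p \<in> G t" if "p \<in> W t" for p using that by (auto simp: D_def W_def)
      then show "fibre_union (W t) Y (G t)" using YD sub unfolding fibre_union_def by blast
    qed
    show "inj_on (\<lambda>x. Y x x) V"
    proof (rule inj_onI)
      fix u w assume u: "u \<in> V" "w \<in> V" "Y u u = Y w w"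
      then have "u \<in> W (c u u)" "w \<in> W (c u u)" using col[of u w] by (auto simp: W_def)
      then show "u = w" using inj_onD[OF inj[of "c u u"] u(3)] by blast
    qed
  qed
  then show ?thesis by blast
qed

section \<open>Quotients by an equivalence relation of the configuration\<close>

lemma refines_sum:
  assumes c: "coherent V c" and E: "refines V c E" and f: "refines V c f"
    and n: "\<And>x y. x \<in> V \<Longrightarrow> y \<in> V \<Longrightarrow> f x y \<le> (n :: nat)"
  shows "refines V c (\<lambda>x y. \<Sum>p | p \<in> V \<and> E x p. f p y)"
proof -
  have fin: "finite V" using c by (rule coherent_finite)
  \<comment> \<open>Grouping the points \<open>p\<close> by the value \<open>k\<close> of
    \<open>f p y\<close> turns the sum into path counts with weight \<open>k\<close>; the bound
    \<open>n\<close> keeps the range of \<open>k\<close> finite.\<close>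
  have *: "(\<Sum>p | p \<in> V \<and> E x p. f p y) = (\<Sum>k\<le>n. k * card {p\<in>V. E x p \<and> f p y = k})"
    if "x \<in> V" "y \<in> V" for x y
  proof -
    have "(\<Sum>k\<le>n. \<Sum>p | p \<in> {p \<in> V. E x p} \<and> f p y = k. f p y) = (\<Sum>p | p \<in> V \<and> E x p. f p y)"
      by (rule sum.group) (use fin n that in auto)
    moreover have "(\<Sum>p | p \<in> {p \<in> V. E x p} \<and> f p y = k. f p y) = k * card {p\<in>V. E x p \<and> f p y = k}" for k
      by (simp add: conj_assoc)
    ultimately show ?thesis by (simp add: mult.commute)
  qed
  show ?thesis
    unfolding refines_def
  proof (intro ballI impI)
    fix x y u v assume V: "x \<in> V" "y \<in> V" "u \<in> V" "v \<in> V" and eq: "c x y = c u v"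
    have "card {p\<in>V. E x p \<and> f p y = k} = card {p\<in>V. E u p \<and> f p v = k}" for k
      by (rule refinesD[OF coherent_card[OF c E refines_comp[OF f, of "\<lambda>s. s = k"]] eq V])
    then show "(\<Sum>p | p \<in> V \<and> E x p. f p y) = (\<Sum>p | p \<in> V \<and> E u p. f p v)"
      using *[OF V(1,2)] *[OF V(3,4)] by simp
  qed
qed

text \<open>This is the union of the basic relations that meet the product of the blocks of
  \<open>x\<close> and \<open>y\<close>. It is defined on points and later restricted to a
  transversal, so that the quotient again lives on a subset of \<open>V\<close> and its colours have
  the type used in the induction.\<close>

definition quotient_colour :: "'a set \<Rightarrow> ('a \<times> 'a) set \<Rightarrow> ('a \<Rightarrow> 'a \<Rightarrow> 'c) \<Rightarrow> 'a \<Rightarrow> 'a \<Rightarrow> ('a \<times> 'a) set" where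
  "quotient_colour V e c x y = {(p, q) \<in> V \<times> V. \<exists>u\<in>V. (x, u) \<in> e \<and> (\<exists>v\<in>V. c p q = c u v \<and> (v, y) \<in> e)}"

lemma quotient_colour_class:
  assumes e: "equiv V e" and "(x, x') \<in> e" "(y, y') \<in> e"
  shows "quotient_colour V e c x y = quotient_colour V e c x' y'"
proof -
  have "(x, u) \<in> e \<longleftrightarrow> (x', u) \<in> e" for u
    using e assms(2) unfolding equiv_def by (meson symD transD)
  moreover have "(v, y) \<in> e \<longleftrightarrow> (v, y') \<in> e" for v
    using e assms(3) unfolding equiv_def by (meson symD transD)
  ultimately show ?thesis unfolding quotient_colour_def by simp
qed

lemma refines_quotient_colour:
  assumes c: "coherent V c" and e: "refines V c (\<lambda>x y. (x, y) \<in> e)"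
  shows "refines V c (quotient_colour V e c)"
  unfolding refines_def
proof (intro ballI impI)
  fix x y u v assume V: "x \<in> V" "y \<in> V" "u \<in> V" "v \<in> V" and eq: "c x y = c u v"
  have "(\<exists>a\<in>V. (x, a) \<in> e \<and> (\<exists>b\<in>V. t = c a b \<and> (b, y) \<in> e))
      = (\<exists>a\<in>V. (u, a) \<in> e \<and> (\<exists>b\<in>V. t = c a b \<and> (b, v) \<in> e))" for t
    by (rule refinesD[OF coherent_relcomp[OF c e
          coherent_relcomp[OF c refines_comp[OF refines_refl, of V c "\<lambda>s. t = s"] e]] eq V])
  then show "quotient_colour V e c x y = quotient_colour V e c u v"
    unfolding quotient_colour_def by simp
qed

lemma quotient_colour_eqD:
  assumes e: "equiv V e" and V: "x \<in> V" "y \<in> V" "u \<in> V" "v \<in> V"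
    and eq: "quotient_colour V e c x y = quotient_colour V e c u v"
  shows "\<exists>a\<in>V. \<exists>b\<in>V. (u, a) \<in> e \<and> (v, b) \<in> e \<and> c x y = c a b"
proof -
  have refl: "(x, x) \<in> e" "(y, y) \<in> e" and "sym e"
    using e V unfolding equiv_def by (auto dest: refl_onD)
  have "(x, y) \<in> quotient_colour V e c x y"
    using V refl unfolding quotient_colour_def by blast
  then have "(x, y) \<in> quotient_colour V e c u v" using eq by simp
  then obtain a b where "a \<in> V" "b \<in> V" "(u, a) \<in> e" "(b, v) \<in> e" "c x y = c a b"
    unfolding quotient_colour_def by blast
  then show ?thesis using \<open>sym e\<close> by (meson symD)
qed

lemma refines_quotient_mono:
  assumes e: "equiv V e" and d: "refines V d c" and c: "coherent V c" "refines V c (\<lambda>x y. (x, y) \<in> e)"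
  shows "refines V (quotient_colour V e d) (quotient_colour V e c)"
  unfolding refines_def
proof (intro ballI impI)
  fix x y u v assume V: "x \<in> V" "y \<in> V" "u \<in> V" "v \<in> V" 
    and eq: "quotient_colour V e d x y = quotient_colour V e d u v"
  obtain a b where ab: "a \<in> V" "b \<in> V" "(u, a) \<in> e" "(v, b) \<in> e" "d x y = d a b"
    using quotient_colour_eqD[OF e V eq] by blast
  have "c x y = c a b" using refinesD[OF d ab(5)] V ab by blast
  then have "quotient_colour V e c x y = quotient_colour V e c a b"
    using refinesD[OF refines_quotient_colour[OF c]] V ab by blast
  then show "quotient_colour V e c x y = quotient_colour V e c u v"
    using quotient_colour_class[OF e ab(3,4)] by (rule trans[OF _ sym])
qed

lemma ex_transversal:
  assumes e: "equiv V e"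
  shows "\<exists>rep. \<forall>x\<in>V. rep x \<in> V \<and> (x, rep x) \<in> e \<and> (\<forall>y\<in>V. rep x = rep y \<longleftrightarrow> (x, y) \<in> e)"
proof -
  define rep where "rep x = (SOME y. y \<in> e `` {x})" for x
  have sub: "e \<subseteq> V \<times> V" using e by (auto simp: equiv_def)
  have rep: "(x, rep x) \<in> e" if "x \<in> V" for x
  proof -
    have "x \<in> e `` {x}" using equiv_class_self[OF e that] .
    then have "rep x \<in> e `` {x}" unfolding rep_def by (rule someI)
    then show ?thesis by simp
  qed
  have "rep x = rep y \<longleftrightarrow> (x, y) \<in> e" if "x \<in> V" "y \<in> V" for x y
  proof
    assume "(x, y) \<in> e"
    then show "rep x = rep y" unfolding rep_def using equiv_class_eq[OF e] by metis
  next
    assume "rep x = rep y"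
    then show "(x, y) \<in> e" using rep[OF that(1)] rep[OF that(2)] e unfolding equiv_def by (metis symD transD)
  qed
  then show ?thesis using rep sub by (intro exI[of _ rep]) blast
qed

text \<open>By \<open>refines_quotient_colour\<close>, paths with prescribed quotient colours are
  counted coherently over \<open>V\<close>. Each admissible midpoint may move freely in its block of
  size \<open>b\<close>, so the count over the transversal is the count over \<open>V\<close>
  divided by \<open>b\<close>.\<close>

lemma coherent_quotient_colour:
  assumes e: "equiv V e" and d: "coherent V d" "refines V d (\<lambda>x y. (x, y) \<in> e)"
    and rep: "\<forall>x\<in>V. rep x \<in> V \<and> (x, rep x) \<in> e \<and> (\<forall>y\<in>V. rep x = rep y \<longleftrightarrow> (x, y) \<in> e)"
    and b: "\<And>x. x \<in> V \<Longrightarrow> card (e `` {x}) = b" "b > 0"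
  shows "coherent (rep ` V) (quotient_colour V e d)"
proof -
  let ?q = "quotient_colour V e d"
  have fin: "finite V" using d(1) by (rule coherent_finite)
  have RV: "rep ` V \<subseteq> V" using rep by blast
  have sub: "e \<subseteq> V \<times> V" using e by (auto simp: equiv_def)
  have idem: "rep z = z" if z: "z \<in> rep ` V" for z
  proof -
    obtain x where x: "x \<in> V" "z = rep x" using z by blast
    then have "rep x = rep z" using rep by blast
    then show ?thesis using x(2) by (rule trans[OF sym sym])
  qed
  have unique: "y = z" if "y \<in> rep ` V" "z \<in> rep ` V" "(y, z) \<in> e" for y z
    using that rep idem RV by (metis subsetD)
  have count: "card {z\<in>V. P z} = b * card {z\<in>rep ` V. P z}"
    if P: "\<And>x y. (x, y) \<in> e \<Longrightarrow> P x = P y" for P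
  proof -
    have "{z\<in>V. P z} = (\<Union>z\<in>{z\<in>rep ` V. P z}. e `` {z})"
    proof (intro subset_antisym subsetI)
      fix z assume z: "z \<in> {z\<in>V. P z}"
      then have "(z, rep z) \<in> e" using rep by blast
      moreover then have "(rep z, z) \<in> e" using e unfolding equiv_def by (blast dest: symD)
      ultimately show "z \<in> (\<Union>z\<in>{z\<in>rep ` V. P z}. e `` {z})" using z P by blast
    qed (use P sub in blast)
    moreover have "card (\<Union>z\<in>{z\<in>rep ` V. P z}. e `` {z}) = (\<Sum>z\<in>{z\<in>rep ` V. P z}. card (e `` {z}))"
    proof (rule card_UN_disjoint)
      show "finite {z\<in>rep ` V. P z}" using fin by simp
      show "\<forall>z\<in>{z\<in>rep ` V. P z}. finite (e `` {z})" using sub fin by (auto intro: finite_subset)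
      show "\<forall>y\<in>{z\<in>rep ` V. P z}. \<forall>z\<in>{z\<in>rep ` V. P z}. y \<noteq> z \<longrightarrow> e `` {y} \<inter> e `` {z} = {}"
      proof (intro ballI impI)
        fix y z assume "y \<in> {z\<in>rep ` V. P z}" "z \<in> {z\<in>rep ` V. P z}" "y \<noteq> z"
        then have "(y, z) \<notin> e" using unique by blast
        then show "e `` {y} \<inter> e `` {z} = {}" using e unfolding equiv_def by (blast dest: symD transD)
      qed
    qed
    moreover have "\<dots> = b * card {z\<in>rep ` V. P z}"
      using b(1) RV by (simp add: subset_iff)
    ultimately show ?thesis by simp
  qed
  show ?thesis
    unfolding coherent_def
  proof (intro conjI ballI impI allI)
    show "finite (rep ` V)" using fin by simp
  next
    fix x y z assume R: "x \<in> rep ` V" "y \<in> rep ` V" "z \<in> rep ` V" and eq: "?q x x = ?q y z"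
    have V: "x \<in> V" "y \<in> V" "z \<in> V" using R RV by auto
    obtain s t where st: "s \<in> V" "t \<in> V" "(y, s) \<in> e" "(z, t) \<in> e" "d x x = d s t"
      using quotient_colour_eqD[OF e V(1,1,2,3) eq] by blast
    then have "s = t" using coherent_diag[OF d(1)] V by blast
    then have "(y, z) \<in> e" using st(3,4) e unfolding equiv_def by (meson symD transD)
    then show "y = z" using unique R by blast
  next
    fix x y u v assume R: "x \<in> rep ` V" "y \<in> rep ` V" "u \<in> rep ` V" "v \<in> rep ` V" and eq: "?q x y = ?q u v"
    have V: "x \<in> V" "y \<in> V" "u \<in> V" "v \<in> V" using R RV by auto
    obtain s t where st: "s \<in> V" "t \<in> V" "(u, s) \<in> e" "(v, t) \<in> e" "d x y = d s t"
      using quotient_colour_eqD[OF e V eq] by blast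
    have "d y x = d t s" by (rule coherent_converse[OF d(1) st(5) V(1,2) st(1,2)])
    then have "?q y x = ?q t s" using refinesD[OF refines_quotient_colour[OF d]] V st by blast
    then show "?q y x = ?q v u" using quotient_colour_class[OF e st(4,3)] by (rule trans[OF _ sym])
  next
    fix x y u v i j assume R: "x \<in> rep ` V" "y \<in> rep ` V" "u \<in> rep ` V" "v \<in> rep ` V" and eq: "?q x y = ?q u v"
    have V: "x \<in> V" "y \<in> V" "u \<in> V" "v \<in> V" using R RV by auto
    obtain s t where st: "s \<in> V" "t \<in> V" "(u, s) \<in> e" "(v, t) \<in> e" "d x y = d s t"
      using quotient_colour_eqD[OF e V eq] by blast
    have q: "refines V d (\<lambda>p r. ?q p r = k)" for k
      using refines_comp[OF refines_quotient_colour[OF d], of "\<lambda>s. s = k"] .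
    have "card {z\<in>V. ?q x z = i \<and> ?q z y = j} = card {z\<in>V. ?q s z = i \<and> ?q z t = j}"
      by (rule refinesD[OF coherent_card[OF d(1) q q] st(5) V(1,2) st(1,2)])
    also have "{z\<in>V. ?q s z = i \<and> ?q z t = j} = {z\<in>V. ?q u z = i \<and> ?q z v = j}"
    proof (rule Collect_cong)
      fix z
      have "?q s z = ?q u z \<and> ?q z t = ?q z v" if "z \<in> V"
        using quotient_colour_class[OF e st(3), of z z] quotient_colour_class[OF e _ st(4), of z z]
          equiv_class_self[OF e that] by auto
      then show "(z \<in> V \<and> ?q s z = i \<and> ?q z t = j) = (z \<in> V \<and> ?q u z = i \<and> ?q z v = j)" by auto
    qed
    finally have "card {z\<in>V. ?q x z = i \<and> ?q z y = j} = card {z\<in>V. ?q u z = i \<and> ?q z v = j}" .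
    moreover have "card {z\<in>V. ?q x z = i \<and> ?q z y = j} = b * card {z\<in>rep ` V. ?q x z = i \<and> ?q z y = j}"
      if "x \<in> V" "y \<in> V" for x y
    proof (rule count)
      fix z w assume "(z, w) \<in> e"
      then show "(?q x z = i \<and> ?q z y = j) = (?q x w = i \<and> ?q w y = j)"
        using quotient_colour_class[OF e, of x x z w] quotient_colour_class[OF e, of z w y y]
          equiv_class_self[OF e that(1)] equiv_class_self[OF e that(2)] by auto
    qed
    ultimately show "card {z\<in>rep ` V. ?q x z = i \<and> ?q z y = j} = card {z\<in>rep ` V. ?q u z = i \<and> ?q z v = j}"
      using V b(2) by simp
  qed
qed

text \<open>If the colours between two blocks \<open>[x]\<close>, \<open>[y]\<close> also occur between \<open>[y]\<close> and \<open>[x]\<close>, then a half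
  system splits the odd number of pairs in \<open>[x] \<times> [y]\<close> into two equal parts.\<close>
lemma antisymmetric_quotient_colour:
  fixes c :: "'a \<Rightarrow> 'a \<Rightarrow> 'c"
  assumes e: "equiv V e" and c: "coherent V c" "refines V c (\<lambda>x y. (x, y) \<in> e)" and a: "antisymmetric V c"
    and odd: "\<And>x. x \<in> V \<Longrightarrow> odd (card (e `` {x}))"
    and V: "x \<in> V" "y \<in> V" and eq: "quotient_colour V e c x y = quotient_colour V e c y x"
  shows "(x, y) \<in> e"
proof (rule ccontr)
  assume xy: "(x, y) \<notin> e"
  have fin: "finite V" using c(1) by (rule coherent_finite)
  have sub: "e \<subseteq> V \<times> V" and sym: "sym e" and trans: "trans e" using e by (auto simp: equiv_def)
  have "x \<noteq> y" using xy equiv_class_self[OF e V(1)] by auto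
  obtain P where "c x y \<in> P" and P: "\<forall>x\<in>V. \<forall>y\<in>V. x \<noteq> y \<longrightarrow> (c x y \<in> P \<longleftrightarrow> c y x \<notin> P)"
    using ex_half_system[OF c(1) a V \<open>x \<noteq> y\<close>] by (elim exE conjE)
  \<comment> \<open>\<open>N u v\<close> is the number of pairs between the blocks of
    \<open>u\<close> and \<open>v\<close> with colour in \<open>P\<close>. Written as a sum of path
    counts, it visibly depends only on the colour \<open>c u v\<close>.\<close>
  define N where "N u v = (\<Sum>p | p \<in> V \<and> (u, p) \<in> e. card {q\<in>V. c p q \<in> P \<and> (q, v) \<in> e})" for u v
  have rN: "refines V c N"
    unfolding N_def
  proof (rule refines_sum[OF c(1,2)])
    have "refines V c (\<lambda>p q. c p q \<in> P)" using refines_comp[OF refines_refl, of V c "\<lambda>s. s \<in> P"] .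
    then show "refines V c (\<lambda>p v. card {q\<in>V. c p q \<in> P \<and> (q, v) \<in> e})"
      by (rule coherent_card[OF c(1) _ c(2)])
    show "card {q\<in>V. c p q \<in> P \<and> (q, v) \<in> e} \<le> card V" for p v using fin by (intro card_mono) auto
  qed
  have N: "N u v = card {(p, q) \<in> e `` {u} \<times> e `` {v}. c p q \<in> P}" for u v
  proof -
    have "{(p, q) \<in> e `` {u} \<times> e `` {v}. c p q \<in> P}
        = (SIGMA p:{p\<in>V. (u, p) \<in> e}. {q\<in>V. c p q \<in> P \<and> (q, v) \<in> e})"
      using sub sym by (auto dest: symD)
    then show ?thesis unfolding N_def using fin by (simp add: card_SigmaI)
  qed
  obtain s t where st: "s \<in> V" "t \<in> V" "(y, s) \<in> e" "(x, t) \<in> e" "c x y = c s t"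
    using quotient_colour_eqD[OF e V V(2,1) eq] by blast
  have "N x y = N s t" by (rule refinesD[OF rN st(5) V st(1,2)])
  also have "\<dots> = N y x"
    unfolding N using equiv_class_eq[OF e st(3)] equiv_class_eq[OF e st(4)] by simp
  finally have Nxy: "N x y = N y x" .
  let ?A = "e `` {x}" and ?B = "e `` {y}"
  have AB: "?A \<subseteq> V" "?B \<subseteq> V" using sub by auto
  have dis: "?A \<inter> ?B = {}" using xy sym trans by (blast dest: symD transD)
  have finAB: "finite ?A" "finite ?B" using AB fin finite_subset by blast+
  have "N y x = card {(p, q) \<in> ?A \<times> ?B. c q p \<in> P}"
    unfolding N by (rule bij_betw_same_card[of prod.swap]) (auto simp: bij_betw_def inj_on_def image_iff)
  \<comment> \<open>The two blocks are disjoint, so \<open>p\<close> and \<open>q\<close> differ and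
    exactly one of \<open>c p q\<close> and \<open>c q p\<close> lies in \<open>P\<close>.\<close>
  also have "{(p, q) \<in> ?A \<times> ?B. c q p \<in> P} = {(p, q) \<in> ?A \<times> ?B. c p q \<notin> P}"
  proof -
    have "c q p \<in> P \<longleftrightarrow> c p q \<notin> P" if "p \<in> ?A" "q \<in> ?B" for p q
      using P[rule_format, of q p] that dis AB by blast
    then show ?thesis by blast
  qed
  finally have "N y x = card {(p, q) \<in> ?A \<times> ?B. c p q \<notin> P}" .
  moreover have "card (?A \<times> ?B) = card {(p, q) \<in> ?A \<times> ?B. c p q \<in> P} + card {(p, q) \<in> ?A \<times> ?B. c p q \<notin> P}"
  proof -
    have "?A \<times> ?B = {(p, q) \<in> ?A \<times> ?B. c p q \<in> P} \<union> {(p, q) \<in> ?A \<times> ?B. c p q \<notin> P}" by blast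
    moreover have "card ({(p, q) \<in> ?A \<times> ?B. c p q \<in> P} \<union> {(p, q) \<in> ?A \<times> ?B. c p q \<notin> P})
      = card {(p, q) \<in> ?A \<times> ?B. c p q \<in> P} + card {(p, q) \<in> ?A \<times> ?B. c p q \<notin> P}"
      by (rule card_Un_disjoint) (auto intro: finite_subset[OF _ finite_cartesian_product[OF finAB]])
    ultimately show ?thesis by presburger
  qed
  ultimately have "card ?A * card ?B = 2 * N x y" using Nxy N by (simp add: card_cartesian_product)
  then have "even (card ?A * card ?B)" by simp
  then show False using odd V by simp
qed

lemma ex_good_imprimitive:
  fixes c :: "'a \<Rightarrow> 'a \<Rightarrow> ('a \<times> 'a) set"
  assumes c: "coherent V c" and a: "antisymmetric V c" and h: "homogeneous V c"
    and e: "equiv V e" "refines V c (\<lambda>x y. (x, y) \<in> e)" "e \<noteq> Id_on V" "e \<noteq> V \<times> V"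
    and IH: "\<And>W (d :: 'a \<Rightarrow> 'a \<Rightarrow> ('a \<times> 'a) set). W \<subset> V \<Longrightarrow> coherent W d \<Longrightarrow> antisymmetric W d \<Longrightarrow> \<exists>D. good W d D"
  shows "\<exists>D. good V c D"
proof -
  have fin: "finite V" using c by (rule coherent_finite)
  have sub: "e \<subseteq> V \<times> V" and sym: "sym e" and trans: "trans e" using e(1) by (auto simp: equiv_def)
  obtain rep where rep: "\<forall>x\<in>V. rep x \<in> V \<and> (x, rep x) \<in> e \<and> (\<forall>y\<in>V. rep x = rep y \<longleftrightarrow> (x, y) \<in> e)"
    using ex_transversal[OF e(1)] by (elim exE)
  have blockV: "e `` {x} \<subseteq> V" for x using sub by blast
  have self: "x \<in> e `` {x}" if "x \<in> V" for x using equiv_class_self[OF e(1) that] .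
  have block_eq: "e `` {x} = e `` {y}" if "(x, y) \<in> e" for x y using equiv_class_eq[OF e(1) that] .
  have block_coh: "coherent (e `` {x}) c" for x
  proof (rule coherent_restrict_rel[OF c e(2) blockV])
    fix p q assume "p \<in> e `` {x}"
    then show "(p, q) \<in> e \<longleftrightarrow> q \<in> e `` {x}" using block_eq[of x p] by auto
  qed
  have block_hom: "homogeneous (e `` {x}) c" for x
    using h blockV[of x] unfolding homogeneous_def by blast
  have block_anti: "antisymmetric (e `` {x}) c" for x by (rule antisymmetric_subset[OF a blockV])
  have block_odd: "odd (card (e `` {x}))" if "x \<in> V" for x
    using odd_card_homogeneous[OF block_coh block_anti block_hom] self[OF that] by blast
  obtain x0 where x0: "x0 \<in> V" using e(3) sub by blast
  define b where "b = card (e `` {x0})"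
  have b: "card (e `` {x}) = b" if "x \<in> V" for x
  proof -
    have "e `` {z} = {y\<in>V. (z, y) \<in> e}" for z using sub by blast
    then show ?thesis unfolding b_def using homogeneous_degree[OF c h e(2) that x0] by simp
  qed
  have "b > 0" using block_odd[OF x0] odd_pos b_def by blast
  have "e `` {x} \<subset> V" if x: "x \<in> V" for x
  proof (rule psubsetI[OF blockV])
    show "e `` {x} \<noteq> V"
    proof
      assume full: "e `` {x} = V"
      have "(p, q) \<in> e" if "p \<in> V" "q \<in> V" for p q
      proof -
        have "(x, p) \<in> e" "(x, q) \<in> e" using full that by blast+
        then show ?thesis using sym trans by (blast dest: symD transD)
      qed
      then show False using e(4) sub by blast
    qed
  qed
  then have ex_block: "\<exists>D. good (e `` {x}) c D" if "x \<in> V" for x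
    using IH[OF _ block_coh block_anti] that by blast
  define g where "g B = (SOME G. good B c G \<and> card B < 2 * card G)" for B
  have g: "good (e `` {x}) c (g (e `` {x})) \<and> card (e `` {x}) < 2 * card (g (e `` {x}))" if x: "x \<in> V" for x
  proof -
    obtain D where "good (e `` {x}) c D" using ex_block[OF x] by blast
    from good_majority[OF this block_odd[OF x] coherent_finite[OF block_coh]]
    show ?thesis unfolding g_def by (rule someI_ex)
  qed
  let ?R = "rep ` V"
  have RV: "?R \<subseteq> V" using rep by blast
  have idem: "rep z = z" if z: "z \<in> ?R" for z
  proof -
    obtain x where x: "x \<in> V" "z = rep x" using z by blast
    then have "rep x = rep z" using rep by blast
    then show ?thesis using x(2) by (rule HOL.trans[OF HOL.sym HOL.sym])
  qed
  have "?R \<subset> V"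
  proof (rule psubsetI[OF RV])
    show "?R \<noteq> V"
    proof
      assume R: "?R = V"
      have rid: "rep p = p" if "p \<in> V" for p using idem R that by simp
      have "e \<subseteq> Id_on V"
      proof (rule subrelI)
        fix p q assume pq: "(p, q) \<in> e"
        then have V: "p \<in> V" "q \<in> V" using sub by auto
        then have "rep p = rep q" using rep pq by simp
        then show "(p, q) \<in> Id_on V" using V rid by (simp add: Id_on_iff)
      qed
      moreover have "Id_on V \<subseteq> e" using self by auto
      ultimately have "e = Id_on V" by (rule subset_antisym)
      then show False using e(3) by contradiction
    qed
  qed
  moreover have "coherent ?R (quotient_colour V e c)"
    by (rule coherent_quotient_colour[OF e(1) c e(2) rep b \<open>b > 0\<close>])
  moreover have "antisymmetric ?R (quotient_colour V e c)"
    unfolding antisymmetric_def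
  proof (intro ballI impI)
    fix x y assume xy: "x \<in> ?R" "y \<in> ?R" and eq: "quotient_colour V e c x y = quotient_colour V e c y x"
    have V: "x \<in> V" "y \<in> V" using subsetD[OF RV] xy by blast+
    have "(x, y) \<in> e" by (rule antisymmetric_quotient_colour[OF e(1) c e(2) a block_odd V eq])
    then have "rep x = rep y" using rep V by blast
    then show "x = y" using idem[OF xy(1)] idem[OF xy(2)] by simp
  qed
  ultimately have "\<exists>Q. good ?R (quotient_colour V e c) Q" by (rule IH)
  then obtain Q where Q: "good ?R (quotient_colour V e c) Q" by (elim exE)
  \<comment> \<open>On a block, \<open>D\<close> is the good majority set if the representative lies
    in \<open>Q\<close> and its complement in the block otherwise. Both choices resolve the block,
    and the size tells them apart.\<close>
  define D where "D = {x\<in>V. x \<in> g (e `` {x}) \<longleftrightarrow> rep x \<in> Q}"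
  have memD: "p \<in> D \<longleftrightarrow> (p \<in> g (e `` {x}) \<longleftrightarrow> rep x \<in> Q)" if x: "x \<in> V" and p: "p \<in> e `` {x}" for p x
  proof -
    have xp: "(x, p) \<in> e" using p by simp
    then have "p \<in> V" using sub by blast
    moreover have "rep p = rep x" using rep x calculation symD[OF sym xp] by simp
    ultimately show ?thesis using block_eq[OF xp] by (simp add: D_def)
  qed
  have major: "card (e `` {x}) < 2 * card {z\<in>V. (x, z) \<in> e \<and> z \<in> D} \<longleftrightarrow> rep x \<in> Q" if x: "x \<in> V" for x
  proof -
    let ?B = "e `` {x}"
    have gB: "g ?B \<subseteq> ?B" "card ?B < 2 * card (g ?B)" using g[OF x] by (auto simp: good_def)
    have finB: "finite ?B" using blockV fin by (rule finite_subset)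
    show ?thesis
    proof (cases "rep x \<in> Q")
      case True
      then have "{z\<in>V. (x, z) \<in> e \<and> z \<in> D} = g ?B" using memD[OF x] gB(1) blockV by blast
      then show ?thesis using True gB by simp
    next
      case False
      then have "{z\<in>V. (x, z) \<in> e \<and> z \<in> D} = ?B - g ?B" using memD[OF x] gB(1) blockV by blast
      moreover have "card (?B - g ?B) = card ?B - card (g ?B)"
        using gB(1) finB by (intro card_Diff_subset) (auto intro: finite_subset)
      ultimately show ?thesis using False gB(2) by simp
    qed
  qed
  have "good V c D"
    unfolding good_def
  proof (intro conjI allI impI)
    show "D \<subseteq> V" by (auto simp: D_def)
  next
    fix Y :: "'a \<Rightarrow> 'a \<Rightarrow> ('a \<times> 'a) set"
    assume Y: "coherent V Y" "refines V Y c" and YD: "fibre_union V Y D"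
    have Ye: "refines V Y (\<lambda>x y. (x, y) \<in> e)" by (rule refines_trans[OF Y(2) e(2)])
    let ?q = "quotient_colour V e Y"
    have eD: "refines V Y (\<lambda>x z. (x, z) \<in> e \<and> z \<in> D)"
      using refines_comp2[OF Ye refines_fibre_union_snd[OF Y(1) YD], of "\<lambda>s t. s \<and> t"] .
    \<comment> \<open>The number of points of \<open>D\<close> in the block of \<open>x\<close> is a
      degree of a relation of \<open>Y\<close>, so it depends only on the \<open>Y\<close>-fiber of
      \<open>x\<close>; by \<open>major\<close> it tells whether the block belongs to
      \<open>Q\<close>.\<close>
    have Qx: "rep x \<in> Q \<longleftrightarrow> rep y \<in> Q" if "x \<in> V" "y \<in> V" "Y x x = Y y y" for x y
      using coherent_degree[OF Y(1) eD that(3,1,2)] major[OF that(1)] major[OF that(2)] b[OF that(1)] b[OF that(2)] by simp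
    have inj: "inj_on (\<lambda>x. ?q x x) ?R"
    proof (rule good_inj_on[OF Q coherent_quotient_colour[OF e(1) Y(1) Ye rep b \<open>b > 0\<close>]
          refines_subset[OF refines_quotient_mono[OF e(1) Y(2) c e(2)] RV]])
      show "fibre_union ?R ?q Q"
        unfolding fibre_union_def
      proof (intro ballI impI)
        fix x y assume xy: "x \<in> ?R" "y \<in> ?R" "?q x x = ?q y y"
        then have V: "x \<in> V" "y \<in> V" using subsetD[OF RV] by blast+
        obtain s t where st: "s \<in> V" "t \<in> V" "(y, s) \<in> e" "(y, t) \<in> e" "Y x x = Y s t"
          using quotient_colour_eqD[OF e(1) V(1,1,2,2) xy(3)] by blast
        have "s = t" by (rule coherent_diag[OF Y(1) st(5) V(1) st(1,2)])
        then have "rep x \<in> Q \<longleftrightarrow> rep s \<in> Q" using Qx[OF V(1) st(1)] st(5) by simp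
        moreover have "rep s = rep y" using rep st(1,3) V(2) by metis
        ultimately show "(x \<in> Q) = (y \<in> Q)" using idem[OF xy(1)] idem[OF xy(2)] by simp
      qed
    qed
    \<comment> \<open>As \<open>Q\<close> resolves the quotient of \<open>Y\<close>, every
      \<open>Y\<close>-fiber lies in one block. The blocks are then unions of
      \<open>Y\<close>-fibers, and the good set of each block can be applied to the restriction of
      \<open>Y\<close>.\<close>
    have same: "(u, w) \<in> e" if u: "u \<in> V" "w \<in> V" "Y u u = Y w w" for u w
    proof -
      have "?q u u = ?q w w" using refinesD[OF refines_quotient_colour[OF Y(1) Ye] u(3)] u by blast
      moreover have "?q z z = ?q (rep z) (rep z)" if "z \<in> V" for z
        using quotient_colour_class[OF e(1)] rep that by blast
      ultimately have "?q (rep u) (rep u) = ?q (rep w) (rep w)" using u by simp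
      then have "rep u = rep w" using inj_onD[OF inj] u by blast
      then show ?thesis using rep u by blast
    qed
    show "inj_on (\<lambda>x. Y x x) V"
    proof (rule inj_onI)
      fix u w assume u: "u \<in> V" "w \<in> V" "Y u u = Y w w"
      let ?B = "e `` {u}"
      have "fibre_union V Y ?B"
        unfolding fibre_union_def
      proof (intro ballI impI)
        fix p q assume "p \<in> V" "q \<in> V" "Y p p = Y q q"
        then have "(p, q) \<in> e" by (rule same)
        then show "p \<in> ?B \<longleftrightarrow> q \<in> ?B" using sym trans by (blast dest: symD transD)
      qed
      then have coh: "coherent ?B Y" by (rule coherent_restrict_fibres[OF Y(1) blockV])
      have "fibre_union ?B Y (g ?B)"
        unfolding fibre_union_def
      proof (intro ballI impI)
        fix p q assume pq: "p \<in> ?B" "q \<in> ?B" "Y p p = Y q q"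
        then have "p \<in> D \<longleftrightarrow> q \<in> D" using YD blockV unfolding fibre_union_def by blast
        then show "p \<in> g ?B \<longleftrightarrow> q \<in> g ?B" using memD[OF u(1) pq(1)] memD[OF u(1) pq(2)] by blast
      qed
      then have "inj_on (\<lambda>x. Y x x) ?B"
        using good_inj_on[OF _ coh refines_subset[OF Y(2) blockV]] g[OF u(1)] by blast
      then show "u = w" using inj_onD[of "\<lambda>x. Y x x"] u(3) self[OF u(1)] same[OF u] by blast
    qed
  qed
  then show ?thesis by blast
qed

text \<open>Induction on the number of points, for coherent colourings by sets of pairs. The
  colouring varies along with the point set, since the induction hypothesis is applied to fibers of
  fissions and to quotients; other colourings are reduced to their coherent closure.\<close>

theorem ex_good:
  fixes c :: "'a \<Rightarrow> 'a \<Rightarrow> 'c"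
  assumes "finite V" "antisymmetric V c"
  shows "\<exists>D. good V c D"
proof -
  have main: "\<exists>D. good V d D" if "coherent V d" "antisymmetric V d" for V and d :: "'a \<Rightarrow> 'a \<Rightarrow> ('a \<times> 'a) set"
    using that
  proof (induction "card V" arbitrary: V d rule: less_induct)
    case less
    have fin: "finite V" using less.prems(1) by (rule coherent_finite)
    have IH: "\<exists>D. good W d D" if "W \<subset> V" "coherent W d" "antisymmetric W d" for W and d :: "'a \<Rightarrow> 'a \<Rightarrow> ('a \<times> 'a) set"
      by (rule less.hyps[OF psubset_card_mono[OF fin that(1)] that(2,3)])
    show ?case
    proof (cases "\<exists>x. V \<subseteq> {x}")
      case True
      then have "good V d {}" by (auto simp: good_def inj_on_def)
      then show ?thesis by blast
    next
      case False
      then obtain x where x: "x \<in> V" "V \<noteq> {x}" by blast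
      show ?thesis
      proof (cases "homogeneous V d")
        case False
        then show ?thesis using ex_good_inhomogeneous[OF less.prems] IH by blast
      next
        case h: True
        show ?thesis
        proof (cases "primitive V d")
          case True
          show ?thesis by (rule ex_good_primitive[OF less.prems h True x IH])
        next
          case False
          then obtain e where "equiv V e" "refines V d (\<lambda>x y. (x, y) \<in> e)" "e \<noteq> Id_on V" "e \<noteq> V \<times> V"
            unfolding primitive_def by blast
          then show ?thesis by (rule ex_good_imprimitive[OF less.prems h _ _ _ _ IH])
        qed
      qed
    qed
  qed
  have "\<exists>D. good V (closure_colour V c) D"
    by (rule main[OF coherent_closure_colour[OF assms(1)] antisymmetric_refines[OF assms(2) refines_closure_colour]])
  then show ?thesis using good_closure_colour by blast
qed

section \<open>Orbital configurations\<close>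

lemma coherent_config_unique:
  assumes "coherent_config \<Omega> S" "s \<in> S" "t \<in> S" "p \<in> s" "p \<in> t"
  shows "s = t"
proof -
  have "\<forall>s\<in>S. \<forall>t\<in>S. s \<noteq> t \<longrightarrow> s \<inter> t = {}"
    using assms(1) unfolding coherent_config_def by (elim conjE)
  then show ?thesis using assms(2-5) by blast
qed

lemma coherent_config_subset:
  assumes "coherent_config \<Omega> S" "s \<in> S"
  shows "s \<subseteq> \<Omega> \<times> \<Omega>"
proof -
  have "\<Union>S = \<Omega> \<times> \<Omega>" using assms(1) unfolding coherent_config_def by (elim conjE)
  then show ?thesis using assms(2) by blast
qed

definition basic_relation :: "('a \<times> 'a) set set \<Rightarrow> 'a \<Rightarrow> 'a \<Rightarrow> ('a \<times> 'a) set" where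
  "basic_relation S x y = (THE s. s \<in> S \<and> (x, y) \<in> s)"

lemma coherent_config_colour:
  assumes S: "coherent_config \<Omega> S"
  shows basic_relation_mem: "x \<in> \<Omega> \<Longrightarrow> y \<in> \<Omega> \<Longrightarrow> basic_relation S x y \<in> S \<and> (x, y) \<in> basic_relation S x y"
    and basic_relation_eq: "s \<in> S \<Longrightarrow> (x, y) \<in> s \<Longrightarrow> basic_relation S x y = s"
    and coherent_basic_relation: "coherent \<Omega> (basic_relation S)"
proof -
  have fin: "finite \<Omega>" using S unfolding coherent_config_def by (elim conjE)
  have Un: "\<Union>S = \<Omega> \<times> \<Omega>" using S unfolding coherent_config_def by (elim conjE)
  let ?d = "basic_relation S"
  have diag: "\<exists>T\<subseteq>S. \<Union>T = Id_on \<Omega>" using S unfolding coherent_config_def by (elim conjE)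
  have conv: "\<forall>s\<in>S. converse s \<in> S" using S unfolding coherent_config_def by (elim conjE)
  have count: "\<forall>r\<in>S. \<forall>s\<in>S. \<forall>t\<in>S. \<exists>c::nat. \<forall>(a,b)\<in>t. card {g. (a,g) \<in> r \<and> (g,b) \<in> s} = c"
    using S unfolding coherent_config_def by (elim conjE)
  show eq: "?d x y = s" if s: "s \<in> S" "(x, y) \<in> s" for s x y
    unfolding basic_relation_def
  proof (rule the_equality)
    show "t = s" if t: "t \<in> S \<and> (x, y) \<in> t" for t
      using coherent_config_unique[OF S _ s(1)] t s(2) by blast
  qed (use s in blast)
  show mem: "?d x y \<in> S \<and> (x, y) \<in> ?d x y" if xy: "x \<in> \<Omega>" "y \<in> \<Omega>" for x y
  proof -
    have "(x, y) \<in> \<Union>S" unfolding Un using xy by simp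
    then obtain s where "s \<in> S" "(x, y) \<in> s" by (elim UnionE)
    then show ?thesis using eq by simp
  qed
  have sub: "s \<subseteq> \<Omega> \<times> \<Omega>" if "s \<in> S" for s using coherent_config_subset[OF S that] .
  have convd: "?d y x = converse (?d x y)" if "x \<in> \<Omega>" "y \<in> \<Omega>" for x y
    using eq[of "converse (?d x y)" y x] conv mem[OF that] by simp
  show "coherent \<Omega> ?d"
    unfolding coherent_def
  proof (intro conjI ballI impI allI)
    show "finite \<Omega>" by (rule fin)
  next
    fix x y z assume V: "x \<in> \<Omega>" "y \<in> \<Omega>" "z \<in> \<Omega>" and e: "?d x x = ?d y z"
    obtain T where T: "T \<subseteq> S" "\<Union>T = Id_on \<Omega>" using diag by (elim exE conjE)
    have "(x, x) \<in> \<Union>T" unfolding T(2) using V(1) by (rule Id_onI)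
    then obtain t where t: "t \<in> T" "(x, x) \<in> t" by (elim UnionE)
    then have "?d x x = t" using eq T(1) by blast
    then have "(y, z) \<in> t" using mem[OF V(2,3)] e by simp
    then have "(y, z) \<in> Id_on \<Omega>" using t(1) T(2) by blast
    then show "y = z" by (simp add: Id_on_iff)
  next
    fix x y u v assume V: "x \<in> \<Omega>" "y \<in> \<Omega>" "u \<in> \<Omega>" "v \<in> \<Omega>" and e: "?d x y = ?d u v"
    show "?d y x = ?d v u" unfolding convd[OF V(1,2)] convd[OF V(3,4)] e ..
  next
    fix x y u v i j assume V: "x \<in> \<Omega>" "y \<in> \<Omega>" "u \<in> \<Omega>" "v \<in> \<Omega>" and e: "?d x y = ?d u v"
    show "card {z\<in>\<Omega>. ?d x z = i \<and> ?d z y = j} = card {z\<in>\<Omega>. ?d u z = i \<and> ?d z v = j}"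
    proof (cases "i \<in> S \<and> j \<in> S")
      case True
      have set: "{z\<in>\<Omega>. ?d a z = i \<and> ?d z b = j} = {g. (a, g) \<in> i \<and> (g, b) \<in> j}" if ab: "a \<in> \<Omega>" "b \<in> \<Omega>" for a b
      proof (intro subset_antisym subsetI)
        fix z assume "z \<in> {z\<in>\<Omega>. ?d a z = i \<and> ?d z b = j}"
        then show "z \<in> {g. (a, g) \<in> i \<and> (g, b) \<in> j}" using mem[of a z] mem[of z b] ab by auto
      next
        fix z assume z: "z \<in> {g. (a, g) \<in> i \<and> (g, b) \<in> j}"
        then have "z \<in> \<Omega>" using sub[of i] True by auto
        then show "z \<in> {z\<in>\<Omega>. ?d a z = i \<and> ?d z b = j}" using z eq[of i a z] eq[of j z b] True by simp
      qed
      obtain n where n: "\<forall>(a,b)\<in>?d x y. card {g. (a,g) \<in> i \<and> (g,b) \<in> j} = n"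
        using count[rule_format, of i j "?d x y"] True mem[OF V(1,2)] by (elim conjE exE) auto
      have "card {g. (x, g) \<in> i \<and> (g, y) \<in> j} = n" using bspec[OF n, of "(x, y)"] mem[OF V(1,2)] by simp
      moreover have "card {g. (u, g) \<in> i \<and> (g, v) \<in> j} = n"
        using bspec[OF n, of "(u, v)"] mem[OF V(3,4)] e by simp
      ultimately show ?thesis using set[OF V(1,2)] set[OF V(3,4)] by simp
    next
      case False
      \<comment> \<open>If \<open>i\<close> or \<open>j\<close> is not a basic relation, it is not
        the colour of any pair in \<open>\<Omega>\<close>, and both counts are zero.\<close>
      have em: "{z\<in>\<Omega>. ?d a z = i \<and> ?d z b = j} = {}" if "a \<in> \<Omega>" "b \<in> \<Omega>" for a b
        using False mem that by blast
      show ?thesis unfolding em[OF V(1,2)] em[OF V(3,4)] ..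
    qed
  qed
qed

lemma basic_relation_subset:
  assumes S: "coherent_config \<Omega> S" and R: "R \<in> relations S" and "s \<in> S" "(x, y) \<in> s" "(x, y) \<in> R"
  shows "s \<subseteq> R"
proof -
  obtain T where T: "T \<subseteq> S" "R = \<Union>T" using R unfolding relations_def by blast
  then obtain t where t: "t \<in> T" "(x, y) \<in> t" using assms(5) by blast
  then have "s = t" using coherent_config_unique[OF S assms(3) _ assms(4)] T(1) by blast
  then show ?thesis using t T by blast
qed

text \<open>Coloured by its own basic relations, an admissible configuration is a coherent
  refinement of \<open>c\<close> with \<open>D\<close> a union of fibers, so goodness makes its
  fibers single points. A basic relation determines the fibers of both ends of its pairs and is
  therefore a single pair.\<close>

lemma Pi_admissible_good:
  fixes c :: "'a \<Rightarrow> 'a \<Rightarrow> ('a \<times> 'a) set"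
  assumes D: "good \<Omega> c D" and c: "\<And>x y. x \<in> \<Omega> \<Longrightarrow> y \<in> \<Omega> \<Longrightarrow> (x, y) \<in> c x y \<and> c x y \<in> S"
    and cS: "\<And>s x y. s \<in> S \<Longrightarrow> (x, y) \<in> s \<Longrightarrow> c x y = s"
    and adm: "Pi_admissible \<Omega> S {D} S'"
  shows "S' = {{(x, y)} | x y. x \<in> \<Omega> \<and> y \<in> \<Omega>}"
proof -
  have S': "coherent_config \<Omega> S'" and fis: "relations S \<subseteq> relations S'"
    and F: "\<exists>F\<subseteq>fibers \<Omega> S'. \<Union>F = D"
    using adm unfolding Pi_admissible_def fission_le_def by auto
  define d where "d = basic_relation S'"
  note dmem = basic_relation_mem[OF S', folded d_def] and deq = basic_relation_eq[OF S', folded d_def]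
    and dcoh = coherent_basic_relation[OF S', folded d_def]
  have ref: "refines \<Omega> d c"
    unfolding refines_def
  proof (intro ballI impI)
    fix x y u v assume V: "x \<in> \<Omega>" "y \<in> \<Omega>" "u \<in> \<Omega>" "v \<in> \<Omega>" and eq: "d x y = d u v"
    have "c x y \<in> relations S" unfolding relations_def using c[OF V(1,2)] by (intro CollectI exI[of _ "{c x y}"]) simp
    then have "c x y \<in> relations S'" using fis by blast
    from basic_relation_subset[OF S' this] have "d x y \<subseteq> c x y" using dmem[OF V(1,2)] c[OF V(1,2)] by blast
    then have "(u, v) \<in> c x y" using dmem[OF V(3,4)] eq by blast
    then show "c x y = c u v" using cS c[OF V(1,2)] by blast
  qed
  have "fibre_union \<Omega> d D"
    unfolding fibre_union_def
  proof -
    obtain F where F: "F \<subseteq> fibers \<Omega> S'" "\<Union>F = D" using F by blast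
    have *: "y \<in> D" if xy: "x \<in> \<Omega>" "y \<in> \<Omega>" "d x x = d y y" "x \<in> D" for x y
    proof -
      obtain G where G: "G \<in> F" "x \<in> G" using xy(4) F(2) by blast
      then have "Id_on G \<in> S'" using F(1) unfolding fibers_def by blast
      then have "d x x = Id_on G" using deq G(2) by blast
      then have "(y, y) \<in> Id_on G" using dmem[OF xy(2,2)] xy(3) by simp
      then show ?thesis using G F(2) by blast
    qed
    show "\<forall>x\<in>\<Omega>. \<forall>y\<in>\<Omega>. d x x = d y y \<longrightarrow> (x \<in> D) = (y \<in> D)"
      using *[OF _ _ _] *[OF _ _ sym] by blast
  qed
  then have inj: "inj_on (\<lambda>x. d x x) \<Omega>" using D dcoh ref by (intro good_inj_on)
  have single: "d x y = {(x, y)}" if V: "x \<in> \<Omega>" "y \<in> \<Omega>" for x y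
  proof -
    have "p = (x, y)" if p: "p \<in> d x y" for p
    proof -
      obtain u v where uv: "p = (u, v)" by (cases p)
      have "d x y \<subseteq> \<Omega> \<times> \<Omega>" using coherent_config_subset[OF S'] dmem[OF V] by blast
      then have uvV: "u \<in> \<Omega>" "v \<in> \<Omega>" using p uv by auto
      have "d u v = d x y" using deq[of "d x y" u v] dmem[OF V] p uv by simp
      then have "d u u = d x x" "d v v = d y y"
        using coherent_fst[OF dcoh _ uvV V] coherent_snd[OF dcoh _ uvV V] by blast+
      then show ?thesis using inj_onD[OF inj] uvV V uv by blast
    qed
    then show ?thesis using dmem[OF V] by blast
  qed
  have "s \<in> S' \<longleftrightarrow> (\<exists>x\<in>\<Omega>. \<exists>y\<in>\<Omega>. s = {(x, y)})" for s
  proof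
    assume s: "s \<in> S'"
    have "\<forall>s\<in>S'. s \<noteq> {}" using S' unfolding coherent_config_def by (elim conjE)
    then have "s \<noteq> {}" "s \<subseteq> \<Omega> \<times> \<Omega>" using s coherent_config_subset[OF S' s] by blast+
    then obtain x y where xy: "x \<in> \<Omega>" "y \<in> \<Omega>" "(x, y) \<in> s" by auto
    then show "\<exists>x\<in>\<Omega>. \<exists>y\<in>\<Omega>. s = {(x, y)}" using deq[OF s xy(3)] single[OF xy(1,2)] by blast
  next
    assume "\<exists>x\<in>\<Omega>. \<exists>y\<in>\<Omega>. s = {(x, y)}"
    then obtain x y where xy: "x \<in> \<Omega>" "y \<in> \<Omega>" "s = {(x, y)}" by blast
    then show "s \<in> S'" using single[OF xy(1,2)] dmem[OF xy(1,2)] by simp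
  qed
  then show ?thesis by blast
qed

lemma coherent_config_discrete:
  assumes "finite \<Omega>"
  shows "coherent_config \<Omega> {{(x, y)} | x y. x \<in> \<Omega> \<and> y \<in> \<Omega>}"
  unfolding coherent_config_def
proof (intro conjI ballI impI)
  show "\<exists>T\<subseteq>{{(x, y)} | x y. x \<in> \<Omega> \<and> y \<in> \<Omega>}. \<Union>T = Id_on \<Omega>"
    by (rule exI[of _ "(\<lambda>x. {(x, x)}) ` \<Omega>"]) auto
qed (use assms in auto)

lemma Pi_admissible_discrete:
  assumes fin: "finite \<Omega>" and S: "\<Union>S \<subseteq> \<Omega> \<times> \<Omega>" and D: "D \<subseteq> \<Omega>"
  shows "Pi_admissible \<Omega> S {D} {{(x, y)} | x y. x \<in> \<Omega> \<and> y \<in> \<Omega>}"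
  unfolding Pi_admissible_def
proof (intro conjI)
  let ?S = "{{(x, y)} | x y. x \<in> \<Omega> \<and> y \<in> \<Omega>}"
  show "coherent_config \<Omega> ?S" by (rule coherent_config_discrete[OF fin])
  show "fission_le S ?S"
    unfolding fission_le_def relations_def
  proof
    fix R assume "R \<in> {\<Union>T |T. T \<subseteq> S}"
    then have R: "R \<subseteq> \<Omega> \<times> \<Omega>" using S by blast
    have "R = \<Union>((\<lambda>p. {p}) ` R)" by simp
    moreover have "(\<lambda>p. {p}) ` R \<subseteq> ?S" using R by auto
    ultimately show "R \<in> {\<Union>T |T. T \<subseteq> ?S}" by (intro CollectI exI[of _ "(\<lambda>p. {p}) ` R"] conjI)
  qed
  have "{x} \<in> fibers \<Omega> ?S" if "x \<in> D" for x
  proof -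
    have "Id_on {x} = {(x, x)}" by (simp add: Id_on_def)
    then show ?thesis unfolding fibers_def using that D by auto
  qed
  then have "(\<lambda>x. {x}) ` D \<subseteq> fibers \<Omega> ?S" by (rule image_subsetI)
  moreover have "\<Union>((\<lambda>x. {x}) ` D) = D" by simp
  ultimately have "\<exists>F\<subseteq>fibers \<Omega> ?S. \<Union>F = D" by (intro exI[of _ "(\<lambda>x. {x}) ` D"] conjI)
  then show "\<forall>P\<in>{D}. \<exists>F\<subseteq>fibers \<Omega> ?S. \<Union>F = P" by simp
qed

section \<open>Orbitals of a permutation group of odd order\<close>

lemma subgroup_BijGroup_Bij: "subgroup G (BijGroup \<Omega>) \<Longrightarrow> g \<in> G \<Longrightarrow> g \<in> Bij \<Omega>"
  by (drule (1) subgroup.mem_carrier) (simp add: BijGroup_def)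

lemma subgroup_BijGroup_mem: "subgroup G (BijGroup \<Omega>) \<Longrightarrow> g \<in> G \<Longrightarrow> x \<in> \<Omega> \<Longrightarrow> g x \<in> \<Omega>"
  by (drule (1) subgroup_BijGroup_Bij) (auto simp: Bij_def bij_betw_def)

lemma BijGroup_mult_apply:
  "g \<in> Bij \<Omega> \<Longrightarrow> h \<in> Bij \<Omega> \<Longrightarrow> x \<in> \<Omega> \<Longrightarrow> (g \<otimes>\<^bsub>BijGroup \<Omega>\<^esub> h) x = g (h x)"
  by (simp add: BijGroup_def compose_def)

lemma BijGroup_one_apply: "x \<in> \<Omega> \<Longrightarrow> \<one>\<^bsub>BijGroup \<Omega>\<^esub> x = x"
  by (simp add: BijGroup_def)

text \<open>The powers of \<open>g\<close> send \<open>x\<close> alternately to \<open>x\<close> and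
  \<open>y\<close>, while the power with the odd exponent \<open>card G\<close> is the
  identity.\<close>

lemma odd_order_no_swap:
  assumes G: "subgroup G (BijGroup \<Omega>)" and fin: "finite \<Omega>" and odd: "odd (card G)"
    and g: "g \<in> G" and x: "x \<in> \<Omega>" "g x = y" "g y = x" "y \<in> \<Omega>"
  shows "x = y"
proof -
  interpret B: group "BijGroup \<Omega>" by (rule group_BijGroup)
  interpret H: group "(BijGroup \<Omega>)\<lparr>carrier := G\<rparr>" by (rule B.subgroup_imp_group[OF G])
  let ?H = "(BijGroup \<Omega>)\<lparr>carrier := G\<rparr>"
  have comp: "(g \<otimes>\<^bsub>?H\<^esub> k) z = g (k z)" if "k \<in> G" "z \<in> \<Omega>" for k z
    using BijGroup_mult_apply[OF subgroup_BijGroup_Bij[OF G g] subgroup_BijGroup_Bij[OF G that(1)] that(2)] by simp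
  have pow: "(g [^]\<^bsub>?H\<^esub> n) x = (if even n then x else y)" for n :: nat
  proof (induction n)
    case 0
    then show ?case using x by (simp add: BijGroup_def)
  next
    case (Suc n)
    have "g [^]\<^bsub>?H\<^esub> n \<in> G" using H.nat_pow_closed[of g n] g by simp
    moreover have "g [^]\<^bsub>?H\<^esub> Suc n = g \<otimes>\<^bsub>?H\<^esub> g [^]\<^bsub>?H\<^esub> n"
      using H.nat_pow_Suc2[of g n] g by simp
    ultimately show ?case using comp[OF _ x(1)] Suc x by simp
  qed
  have "g [^]\<^bsub>?H\<^esub> card G = \<one>\<^bsub>?H\<^esub>"
    using H.pow_order_eq_1[of g] g by (simp add: order_def)
  then have "y = \<one>\<^bsub>?H\<^esub> x" using pow[of "card G"] odd by simp
  then show ?thesis using x by (simp add: BijGroup_def)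
qed

definition orbital :: "('a \<Rightarrow> 'a) set \<Rightarrow> 'a \<Rightarrow> 'a \<Rightarrow> ('a \<times> 'a) set" where
  "orbital G x y = {(g x, g y) | g. g \<in> G}"

lemma orbital_mem:
  assumes G: "subgroup G (BijGroup \<Omega>)" and "x \<in> \<Omega>" "y \<in> \<Omega>"
  shows "(x, y) \<in> orbital G x y"
proof -
  have "(\<lambda>x\<in>\<Omega>. x) \<in> G" using subgroup.one_closed[OF G] by (simp add: BijGroup_def)
  moreover have "(x, y) = ((\<lambda>x\<in>\<Omega>. x) x, (\<lambda>x\<in>\<Omega>. x) y)" using assms(2,3) by simp
  ultimately show ?thesis unfolding orbital_def by blast
qed

lemma orbital_eq:
  assumes G: "subgroup G (BijGroup \<Omega>)" and ab: "a \<in> \<Omega>" "b \<in> \<Omega>" and "(x, y) \<in> orbital G a b"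
  shows "orbital G x y = orbital G a b"
proof -
  interpret B: group "BijGroup \<Omega>" by (rule group_BijGroup)
  obtain h where h: "h \<in> G" "x = h a" "y = h b" using assms(4) unfolding orbital_def by blast
  note bij = subgroup_BijGroup_Bij[OF G]
  have comp: "\<exists>k\<in>G. \<forall>z\<in>\<Omega>. k z = f (g z)" if "f \<in> G" "g \<in> G" for f g
    using subgroup.m_closed[OF G that] BijGroup_mult_apply[OF bij[OF that(1)] bij[OF that(2)]] by blast
  let ?h = "inv\<^bsub>BijGroup \<Omega>\<^esub> h"
  have hG: "?h \<in> G" by (rule subgroup.m_inv_closed[OF G h(1)])
  have hinv: "?h (h z) = z" if "z \<in> \<Omega>" for z
  proof -
    have "?h \<otimes>\<^bsub>BijGroup \<Omega>\<^esub> h = \<one>\<^bsub>BijGroup \<Omega>\<^esub>"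
      using B.l_inv[of h] subgroup.mem_carrier[OF G h(1)] by simp
    then show ?thesis
      using BijGroup_mult_apply[OF bij[OF hG] bij[OF h(1)] that] BijGroup_one_apply[OF that] by simp
  qed
  show ?thesis
  proof (intro subset_antisym subrelI)
    fix p q assume "(p, q) \<in> orbital G x y"
    then obtain f where f: "f \<in> G" "p = f x" "q = f y" unfolding orbital_def by blast
    obtain k where k: "k \<in> G" "\<forall>z\<in>\<Omega>. k z = f (h z)" using comp[OF f(1) h(1)] by blast
    have "p = k a" "q = k b" using k(2) ab f(2,3) h(2,3) by simp_all
    then show "(p, q) \<in> orbital G a b" unfolding orbital_def using k(1) by blast
  next
    fix p q assume "(p, q) \<in> orbital G a b"
    then obtain f where f: "f \<in> G" "p = f a" "q = f b" unfolding orbital_def by blast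
    obtain k where k: "k \<in> G" "\<forall>z\<in>\<Omega>. k z = f (?h z)" using comp[OF f(1) hG] by blast
    have "p = k x" "q = k y"
      using k(2) subgroup_BijGroup_mem[OF G h(1)] hinv ab f(2,3) h(2,3) by simp_all
    then show "(p, q) \<in> orbital G x y" unfolding orbital_def using k(1) by blast
  qed
qed

theorem theorem1p2:
  fixes \<Omega> :: "'a set" and G :: "('a \<Rightarrow> 'a) set"
  assumes "finite \<Omega>"
    and "subgroup G (BijGroup \<Omega>)"
    and "odd (card G)"
  shows "gb \<Omega> (Inv \<Omega> G) \<le> 1"
proof -
  have Inv: "Inv \<Omega> G = {orbital G x y | x y. x \<in> \<Omega> \<and> y \<in> \<Omega>}"
    unfolding Inv_def orbital_def by (rule refl)
  have anti: "antisymmetric \<Omega> (orbital G)"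
    unfolding antisymmetric_def
  proof (intro ballI impI)
    fix x y assume V: "x \<in> \<Omega>" "y \<in> \<Omega>" and eq: "orbital G x y = orbital G y x"
    have "(y, x) \<in> orbital G x y" unfolding eq by (rule orbital_mem[OF assms(2) V(2,1)])
    then obtain g where g: "g \<in> G" "g x = y" "g y = x" unfolding orbital_def by auto
    show "x = y" by (rule odd_order_no_swap[OF assms(2,1,3) g(1) V(1) g(2,3) V(2)])
  qed
  obtain D where D: "good \<Omega> (orbital G) D" using ex_good[OF assms(1) anti] by (elim exE)
  then have DO: "D \<subseteq> \<Omega>" by (simp add: good_def)
  let ?S = "{{(x, y)} | x y. x \<in> \<Omega> \<and> y \<in> \<Omega>}"
  have colour: "orbital G x y = s" if s: "s \<in> Inv \<Omega> G" "(x, y) \<in> s" for s x y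
  proof -
    obtain a b where "a \<in> \<Omega>" "b \<in> \<Omega>" "s = orbital G a b" using s(1) unfolding Inv by blast
    then show ?thesis using orbital_eq[OF assms(2)] s(2) by blast
  qed
  have mem: "(x, y) \<in> orbital G x y \<and> orbital G x y \<in> Inv \<Omega> G" if "x \<in> \<Omega>" "y \<in> \<Omega>" for x y
    unfolding Inv using orbital_mem[OF assms(2) that] that by blast
  \<comment> \<open>With \<open>{D}\<close> prescribed, the discrete configuration is the only
    admissible one, so its being the smallest is immediate.\<close>
  have unique: "S' = ?S" if "Pi_admissible \<Omega> (Inv \<Omega> G) {D} S'" for S'
    by (rule Pi_admissible_good[OF D mem colour that])
  have "\<Union>(Inv \<Omega> G) \<subseteq> \<Omega> \<times> \<Omega>"
    using subgroup_BijGroup_mem[OF assms(2)] unfolding Inv_def by blast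
  then have "Pi_admissible \<Omega> (Inv \<Omega> G) {D} ?S" by (rule Pi_admissible_discrete[OF assms(1) _ DO])
  then have "is_Pi_fission \<Omega> (Inv \<Omega> G) {D} ?S"
    unfolding is_Pi_fission_def
  proof (intro conjI allI impI)
    fix S' assume "Pi_admissible \<Omega> (Inv \<Omega> G) {D} S'"
    from unique[OF this] show "fission_le ?S S'" by (simp add: fission_le_def)
  qed
  moreover have "complete_cc ?S" unfolding complete_cc_def by blast
  ultimately have "generalized_base \<Omega> (Inv \<Omega> G) {D}"
    unfolding generalized_base_def using DO by (intro conjI exI[of _ ?S]) simp_all
  then show ?thesis
    unfolding gb_def by (intro Least_le exI[of _ "{D}"]) simp
qed

end
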